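(* Let $f\in L^2(\mathbb C)$ be such that for each $k\in\mathbb Z_+$ the function $z\mapsto e^{\frac14|z|^2}\,(f\times\varphi_k^0)(z)$ is a polynomial (in $z$ and $\bar z$). Suppose $f\times\mu_r(x)=0$ for all $r>0$ and all $x\in\mathbb R\subset\mathbb C$. Then $f=0$ almost everywhere.
   Context: $\mathbb Z_+$ is the set of non-negative integers, and $L^2(\mathbb C)$ is taken with respect to Lebesgue measure. For $r>0$, $\mu_r$ is the normalized arc-length measure on the circle $\{w\in\mathbb C:|w|=r\}$, and the twisted spherical mean of $f$ is $$f\times\mu_r(z)=\int_{|w|=r} f(z-w)\,e^{\frac i2\operatorname{Im}(z\bar w)}\,d\mu_r(w).$$ The twisted convolution of functions is $f\times g(z)=\int_{\mathbb C} f(z-w)g(w)e^{\frac i2\operatorname{Im}(z\bar w)}\,dw$. The Laguerre function is $\varphi_k^0(z)=L_k^0(\tfrac12|z|^2)e^{-\frac14|z|^2}$, where $L_k^\alpha(x)=\sum_{j=0}^k(-1)^j\binom{k+\alpha}{k-j}\frac{x^j}{j!}$. *)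

theory Defs
  imports "HOL-Analysis.Analysis"
begin

definition square_integrable :: "(complex \<Rightarrow> complex) \<Rightarrow> bool" where
  "square_integrable f \<longleftrightarrow>
     f \<in> borel_measurable lebesgue \<and> integrable lebesgue (\<lambda>z. (cmod (f z))\<^sup>2)"

definition twist :: "complex \<Rightarrow> complex \<Rightarrow> complex" where
  "twist z w = exp (\<i> / 2 * complex_of_real (Im (z * cnj w)))"

definition twisted_conv ::
    "(complex \<Rightarrow> complex) \<Rightarrow> (complex \<Rightarrow> complex) \<Rightarrow> complex \<Rightarrow> complex" where
  "twisted_conv f g z = (LINT w|lebesgue. f (z - w) * g w * twist z w)"

(* For r > 0 the curve t \<mapsto> r * cis t on [0, 2 * pi] has constant speed r, so normalized
   arc length is the image of the uniform distribution on [0, 2 * pi].  The completion makes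
   the null sets of the circle measurable: f is only assumed to be Lebesgue measurable on the
   plane, so its restriction to a circle need not be Borel even where it is integrable. *)
definition circle_measure :: "real \<Rightarrow> complex measure" where
  "circle_measure r =
     completion (distr (uniform_measure lborel {0..2 * pi}) borel
       (\<lambda>t. complex_of_real r * cis t))"

(* The Bochner integral is 0 where the integrand is not integrable.  For f in L^2 and a fixed
   z this can only happen for r in a null set, because f is locally integrable. *)
definition twisted_spherical_mean ::
    "(complex \<Rightarrow> complex) \<Rightarrow> real \<Rightarrow> complex \<Rightarrow> complex" where
  "twisted_spherical_mean f r z = (LINT w|circle_measure r. f (z - w) * twist z w)"

definition laguerre :: "nat \<Rightarrow> real \<Rightarrow> real \<Rightarrow> real" where
  "laguerre k \<alpha> x =
     (\<Sum>j=0..k. (-1) ^ j * ((real k + \<alpha>) gchoose (k - j)) * x ^ j / fact j)"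

definition laguerre_fun :: "nat \<Rightarrow> complex \<Rightarrow> complex" where
  "laguerre_fun k z =
     complex_of_real (laguerre k 0 ((cmod z)\<^sup>2 / 2) * exp (- (cmod z)\<^sup>2 / 4))"

definition polynomial_z_cnj :: "(complex \<Rightarrow> complex) \<Rightarrow> bool" where
  "polynomial_z_cnj p \<longleftrightarrow>
     (\<exists>(n::nat) (c :: nat \<Rightarrow> nat \<Rightarrow> complex).
        \<forall>z. p z = (\<Sum>i\<le>n. \<Sum>j\<le>n. c i j * z ^ i * cnj z ^ j))"

end

theory Submission
  imports Defs "HOL-Probability.Probability"
begin

text \<open>
  Since \<open>\<phi>_k\<close> is radial, the vanishing of the spherical means centred at \<open>x\<close> gives
  \<open>(f \<times> \<phi>_k) x = 0\<close> for real \<open>x\<close>. The function \<open>exp (|z|^2 / 4) (f \<times> \<phi>_k) z\<close> has an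
  everywhere convergent expansion \<open>\<Sum> c_ab z^a cnj(z)^b\<close> with \<open>a \<le> k\<close>, whose coefficients satisfy
  \<open>2 (a + 1) (b + 1) c_(a+1)(b+1) = (a - k) c_ab\<close> because \<open>f \<times> \<phi>_k\<close> is an eigenfunction of the
  twisted Laplacian. If the expansion is finite and \<open>b\<close> is the largest index with \<open>c_kb \<noteq> 0\<close>, the
  recurrence shows that \<open>c_kb\<close> is the only contribution to the coefficient of \<open>x^(k+b)\<close> on the real
  line, so it is zero. Hence all \<open>c_kb\<close> vanish. They are triangular combinations of the moments
  of \<open>f(w) exp (- |w|^2 / 4)\<close>, so all these moments vanish.

  Expanding \<open>exp (- (s / 2) |w|^2)\<close> shows that vanishing moments of \<open>f(w) exp (- s |w|^2)\<close> imply
  vanishing moments of \<open>f(w) exp (- (3 s / 2) |w|^2)\<close>. Thus \<open>f(w) exp (- |w|^2 / 4)\<close> is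
  orthogonal to translates of arbitrarily narrow Gaussians, and therefore zero almost everywhere.
\<close>

subsection \<open>Rotations and circular means\<close>

text \<open>Identifies the plane with \<open>real ^ 2\<close>, so that rotations can be treated as
  orthogonal transformations of a space of vectors.\<close>

definition vec_complex :: "real ^ 2 \<Rightarrow> complex" where
  "vec_complex v = Complex (v $ 1) (v $ 2)"

lemma measurable_vec_complex [measurable]: "vec_complex \<in> borel \<rightarrow>\<^sub>M borel"
  unfolding vec_complex_def Complex_eq by (intro borel_measurable_continuous_onI continuous_intros)

lemma distr_vec_complex: "distr lborel borel vec_complex = lborel"
proof (rule lborel_eqI[symmetric])
  fix l u :: complex
  assume le: "\<And>b. b \<in> Basis \<Longrightarrow> l \<bullet> b \<le> u \<bullet> b"
  define a b :: "real ^ 2" where "a = vector [Re l, Im l]" and "b = vector [Re u, Im u]"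
  have le': "Re l \<le> Re u" "Im l \<le> Im u"
    using le[of 1] le[of \<i>] by (auto simp: Basis_complex_def)
  have le2: "a \<bullet> i \<le> b \<bullet> i" if "i \<in> Basis" for i
    using that le' by (auto simp: Basis_vec_def a_def b_def inner_axis exhaust_2 UNIV_2)
  have eq: "vec_complex -` box l u = box a b"
    by (auto simp: vec_complex_def box_def Basis_complex_def a_def b_def Basis_vec_def
        inner_axis UNIV_2 forall_2)
  have "emeasure lborel (box a b) = (\<Prod>i\<in>Basis. (b - a) \<bullet> i)"
    using le2 by (simp add: emeasure_lborel_box_eq)
  also have "(\<Prod>i\<in>Basis. (b - a) \<bullet> i) = (\<Prod>i\<in>UNIV. (b - a) $ i)"
    unfolding Basis_vec_def
    by (simp add: inner_axis UN_singleton prod.reindex axis_eq_axis inj_on_def UNION_singleton_eq_range)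
  also have "\<dots> = (\<Prod>i\<in>Basis. (u - l) \<bullet> i)"
    by (simp add: UNIV_2 a_def b_def Basis_complex_def)
  finally show "emeasure (distr lborel borel vec_complex) (box l u) = (\<Prod>i\<in>Basis. (u - l) \<bullet> i)"
    by (simp add: emeasure_distr eq)
qed simp

text \<open>The preimage of a box is its image under \<open>inv R\<close>, which is again orthogonal
  and so preserves measure. Values on boxes determine Lebesgue measure.\<close>

lemma distr_lborel_orthogonal:
  fixes R :: "real ^ 'n::{finite,wellorder} \<Rightarrow> real ^ 'n::_"
  assumes R: "orthogonal_transformation R"
  shows "distr lborel borel R = lborel"
proof (rule lborel_eqI[symmetric])
  fix l u :: "real ^ 'n::_"
  assume le: "\<And>b. b \<in> Basis \<Longrightarrow> l \<bullet> b \<le> u \<bullet> b"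
  have [measurable]: "R \<in> borel \<rightarrow>\<^sub>M borel"
    using R by (intro borel_measurable_continuous_onI linear_continuous_on linear_conv_bounded_linear[THEN iffD1]
        orthogonal_transformation_linear)
  have eq: "R -` box l u = inv R ` box l u"
    using orthogonal_transformation_bij[OF R] by (simp add: bij_vimage_eq_inv_image)
  have invR: "orthogonal_transformation (inv R)"
    using R by (rule orthogonal_transformation_inv)
  have lm: "R -` box l u \<in> lmeasurable"
    unfolding eq by (rule measurable_orthogonal_image[OF invR]) simp
  have "measure lebesgue (R -` box l u) = measure lebesgue (box l u)"
    unfolding eq by (rule measure_orthogonal_image[OF invR]) simp
  moreover have "R -` box l u \<in> sets borel"
    using measurable_sets[of R borel borel "box l u"] by simp
  ultimately have "emeasure lborel (R -` box l u) = emeasure lborel (box l u)"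
    using emeasure_eq_measure2[OF lm] emeasure_eq_measure2[of "box l u" lebesgue]
    by (simp add: emeasure_completion)
  then show "emeasure (distr lborel borel R) (box l u) = (\<Prod>b\<in>Basis. (u - l) \<bullet> b)"
    using le by (simp add: emeasure_distr emeasure_lborel_box_eq)
qed simp

text \<open>Under \<open>vec_complex\<close>, multiplication by \<open>cis \<theta>\<close>
  corresponds to the rotation matrix \<open>R\<close>.\<close>

lemma distr_lborel_cis_mult: "distr lborel borel (\<lambda>z. cis \<theta> * z) = lborel"
proof -
  define R :: "real ^ 2 \<Rightarrow> real ^ 2" where
    "R v = vector [cos \<theta> * v $ 1 - sin \<theta> * v $ 2, sin \<theta> * v $ 1 + cos \<theta> * v $ 2]" for v
  have lin: "linear R"
    by (rule linearI) (auto simp: R_def vec_eq_iff forall_2 algebra_simps)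
  have "norm (R v) = norm v" for v
  proof -
    have "(cos \<theta> * v $ 1 - sin \<theta> * v $ 2)\<^sup>2 + (sin \<theta> * v $ 1 + cos \<theta> * v $ 2)\<^sup>2
        = ((sin \<theta>)\<^sup>2 + (cos \<theta>)\<^sup>2) * ((v $ 1)\<^sup>2 + (v $ 2)\<^sup>2)"
      by algebra
    then show ?thesis
      by (simp add: R_def norm_vec_def L2_set_def UNIV_2)
  qed
  with lin have R: "orthogonal_transformation R"
    by (simp add: orthogonal_transformation)
  have [measurable]: "R \<in> borel \<rightarrow>\<^sub>M borel"
    using lin by (intro borel_measurable_continuous_onI linear_continuous_on linear_conv_bounded_linear[THEN iffD1])
  have eq: "(\<lambda>v. cis \<theta> * vec_complex v) = (\<lambda>v. vec_complex (R v))"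
    by (auto simp: vec_complex_def R_def complex_eq_iff)
  have "distr lborel borel (\<lambda>z. cis \<theta> * z)
      = distr (distr lborel borel vec_complex) borel (\<lambda>z. cis \<theta> * z)"
    by (simp add: distr_vec_complex)
  also have "\<dots> = distr lborel borel (\<lambda>v. cis \<theta> * vec_complex v)"
    by (subst distr_distr) (auto simp: o_def)
  also have "\<dots> = distr (distr lborel borel R) borel vec_complex"
    by (subst distr_distr) (auto simp: o_def eq)
  also have "\<dots> = lborel"
    by (simp add: distr_lborel_orthogonal[OF R] distr_vec_complex)
  finally show ?thesis .
qed

section \<open>Uniform angles and arc length on circles\<close>

definition unif_angle :: "real measure" where
  "unif_angle = uniform_measure lborel {0..2 * pi}"

lemma sets_unif_angle [measurable_cong, simp]: "sets unif_angle = sets borel"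
  by (simp add: unif_angle_def)

lemma space_unif_angle [simp]: "space unif_angle = UNIV"
  by (simp add: unif_angle_def)

lemma prob_space_unif_angle: "prob_space unif_angle"
  unfolding unif_angle_def by (rule prob_space_uniform_measure) auto

lemma emeasure_lborel_translate:
  fixes c :: "'a::euclidean_space"
  assumes [measurable]: "A \<in> sets borel"
  shows "emeasure lborel ((+) c -` A) = emeasure lborel A"
proof -
  have "emeasure lborel A = emeasure (distr lborel borel ((+) c)) A"
    by (simp add: lborel_distr_plus)
  also have "\<dots> = emeasure lborel ((+) c -` A)"
    by (simp add: emeasure_distr)
  finally show ?thesis by simp
qed

text \<open>The shift moves the window from 0 to 2 pi to the one from \<alpha> to 2 pi + \<alpha>.
  By periodicity the part beyond 2 pi can be carried back to the start, where it fills the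
  gap.\<close>

lemma emeasure_unif_angle_shift:
  assumes [measurable]: "A \<in> sets borel" and per: "\<And>t. t + 2 * pi \<in> A \<longleftrightarrow> t \<in> A"
    and \<alpha>: "0 \<le> \<alpha>" "\<alpha> < 2 * pi"
  shows "emeasure unif_angle ((+) \<alpha> -` A) = emeasure unif_angle A"
proof -
  have [measurable]: "(+) \<alpha> -` A \<in> sets borel"
    using measurable_sets[of "(+) \<alpha>" borel borel A] by simp
  have un: "emeasure lborel ({0..<c} \<inter> A) + emeasure lborel ({c..<2*pi} \<inter> A)
     = emeasure lborel ({0..<2*pi} \<inter> A)" if "0 \<le> c" "c < 2*pi" for c
  proof -
    have "{0..<2*pi} \<inter> A = ({0..<c} \<inter> A) \<union> ({c..<2*pi} \<inter> A)" using that by auto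
    then show ?thesis by (simp add: plus_emeasure disjoint_iff)
  qed
  \<comment> \<open>The uniform measure lives on a closed interval, whereas windows are cut into
    half-open pieces; the two differ by one point.\<close>
  have ends: "emeasure lborel ({0..2*pi} \<inter> B) = emeasure lborel ({0..<2*pi} \<inter> B)"
    if [measurable]: "B \<in> sets borel" for B
  proof (rule emeasure_eq_AE)
    show "AE x in lborel. (x \<in> {0..2*pi} \<inter> B) = (x \<in> {0..<2*pi} \<inter> B)"
      using AE_lborel_singleton[of "2*pi"] by eventually_elim auto
  qed auto
  have "emeasure lborel ({0..<2*pi} \<inter> ((+) \<alpha> -` A))
      = emeasure lborel ((+) \<alpha> -` ({\<alpha>..<2*pi+\<alpha>} \<inter> A))"
    by (rule arg_cong[where f="emeasure lborel"]) auto
  also have "\<dots> = emeasure lborel ({\<alpha>..<2*pi+\<alpha>} \<inter> A)"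
    by (rule emeasure_lborel_translate) simp
  also have "{\<alpha>..<2*pi+\<alpha>} \<inter> A = ({\<alpha>..<2*pi} \<inter> A) \<union> ({2*pi..<2*pi+\<alpha>} \<inter> A)"
    using \<alpha> by auto
  also have "emeasure lborel \<dots> = emeasure lborel ({\<alpha>..<2*pi} \<inter> A) + emeasure lborel ({2*pi..<2*pi+\<alpha>} \<inter> A)"
    by (rule plus_emeasure[symmetric]) (auto simp: disjoint_iff)
  also have "emeasure lborel ({2*pi..<2*pi+\<alpha>} \<inter> A)
      = emeasure lborel ((+) (2*pi) -` ({2*pi..<2*pi+\<alpha>} \<inter> A))"
    by (rule emeasure_lborel_translate[symmetric]) simp
  also have "(+) (2*pi) -` ({2*pi..<2*pi+\<alpha>} \<inter> A) = {0..<\<alpha>} \<inter> A"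
    using per by (auto simp: vimage_def per[unfolded add.commute[of _ "2 * pi"]])
  finally have "emeasure lborel ({0..2*pi} \<inter> ((+) \<alpha> -` A)) = emeasure lborel ({0..2*pi} \<inter> A)"
    using un[OF \<alpha>] by (simp add: ends add.commute[of "emeasure lborel ({\<alpha>..<2*pi} \<inter> A)"])
  then show ?thesis
    by (simp add: unif_angle_def)
qed

text \<open>The Borel measure whose completion is \<open>circle_measure\<close>.\<close>

definition circle :: "real \<Rightarrow> complex measure" where
  "circle r = distr unif_angle borel (\<lambda>t. complex_of_real r * cis t)"

lemma measurable_cis [measurable]: "cis \<in> borel \<rightarrow>\<^sub>M borel"
  by (intro borel_measurable_continuous_onI continuous_intros)

text \<open>In polar form, \<open>cis t * w\<close> is the standard parametrization of the circle
  with \<open>t\<close> shifted by \<open>Arg2pi w\<close>, and preimages under that parametrization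
  are 2 pi periodic.\<close>

lemma distr_unif_angle_rotate:
  assumes "w \<noteq> 0"
  shows "distr unif_angle borel (\<lambda>t. cis t * w) = circle (cmod w)"
proof (rule measure_eqI)
  show "sets (distr unif_angle borel (\<lambda>t. cis t * w)) = sets (circle (cmod w))"
    by (simp add: circle_def)
  fix A assume "A \<in> sets (distr unif_angle borel (\<lambda>t. cis t * w))"
  then have [measurable]: "A \<in> sets borel" by simp
  define S where "S = (\<lambda>t. complex_of_real (cmod w) * cis t) -` A"
  have "(\<lambda>t. complex_of_real (cmod w) * cis t) \<in> borel \<rightarrow>\<^sub>M borel" by measurable
  from measurable_sets[OF this \<open>A \<in> sets borel\<close>] have S [measurable]: "S \<in> sets borel"
    by (simp only: S_def space_borel Int_UNIV_right)
  have w: "w = complex_of_real (cmod w) * cis (Arg2pi w)"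
    using Arg2pi_eq[of w] by (simp add: exp_eq_polar)
  have "(\<lambda>t. cis t * w) -` A = (+) (Arg2pi w) -` S"
    by (subst w) (auto simp: S_def cis_mult[symmetric] mult_ac)
  then have "emeasure (distr unif_angle borel (\<lambda>t. cis t * w)) A = emeasure unif_angle ((+) (Arg2pi w) -` S)"
    by (simp add: emeasure_distr)
  also have "\<dots> = emeasure unif_angle S"
    by (rule emeasure_unif_angle_shift[OF S]) (auto simp: S_def Arg2pi_lt_2pi Arg2pi_ge_0 cis_mult[symmetric])
  finally show "emeasure (distr unif_angle borel (\<lambda>t. cis t * w)) A = emeasure (circle (cmod w)) A"
    by (simp add: circle_def emeasure_distr S_def)
qed

lemma circle_measure_eq: "circle_measure r = completion (circle r)"
  by (simp add: circle_measure_def circle_def unif_angle_def)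

lemma sets_circle [measurable_cong, simp]: "sets (circle r) = sets borel"
  by (simp add: circle_def)

text \<open>Every rotated copy of \<open>N\<close> is null. By Fubini over angle and plane, almost
  every \<open>w\<close> therefore has an orbit under rotation that meets \<open>N\<close> in arc
  length zero, and this orbit is the circle of radius \<open>cmod w\<close>.\<close>

lemma AE_circle_null_set:
  assumes N: "N \<in> null_sets lborel"
  shows "AE w in lborel. AE z in circle (cmod w). z \<notin> N"
proof -
  interpret U: prob_space unif_angle by (rule prob_space_unif_angle)
  interpret P: pair_sigma_finite unif_angle "lborel :: complex measure" ..
  have [measurable]: "N \<in> sets borel" using N by auto
  have meas: "(\<lambda>w. cis \<theta> * w) \<in> borel \<rightarrow>\<^sub>M borel" for \<theta> by simp
  have "(\<integral>\<^sup>+ w. \<integral>\<^sup>+ t. indicator N (cis t * w) \<partial>unif_angle \<partial>lborel)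
      = (\<integral>\<^sup>+ t. \<integral>\<^sup>+ w. indicator N (cis t * w) \<partial>lborel \<partial>unif_angle)"
    by (rule P.Fubini') measurable
  also have "(\<integral>\<^sup>+ w. indicator N (cis t * w) \<partial>lborel) = (\<integral>\<^sup>+ w. indicator N w \<partial>distr lborel borel (\<lambda>w. cis t * w))" for t
    by (subst nn_integral_distr) auto
  then have "(\<integral>\<^sup>+ t. \<integral>\<^sup>+ w. indicator N (cis t * w) \<partial>lborel \<partial>unif_angle) = 0"
    using N by (simp add: distr_lborel_cis_mult null_setsD1)
  finally have "AE w in lborel. (\<integral>\<^sup>+ t. indicator N (cis t * w) \<partial>unif_angle) = 0"
    by (subst (asm) nn_integral_0_iff_AE) auto
  then show ?thesis
    using AE_lborel_singleton[of 0]
  proof eventually_elim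
    case (elim w)
    have "(\<integral>\<^sup>+ t. indicator N (cis t * w) \<partial>unif_angle) = (\<integral>\<^sup>+ z. indicator N z \<partial>circle (cmod w))"
      unfolding distr_unif_angle_rotate[OF elim(2), symmetric]
      by (subst nn_integral_distr) auto
    then have "emeasure (circle (cmod w)) N = 0" using elim by simp
    then show ?case
      by (intro AE_not_in) (auto simp: null_sets_def)
  qed
qed

section \<open>Replacing functions by almost everywhere equal ones under a completed measure\<close>

lemma measurable_completion_AE:
  assumes g: "g \<in> M \<rightarrow>\<^sub>M N" and ae: "AE x in M. f x = g x" and f: "f \<in> space M \<rightarrow> space N"
  shows "f \<in> completion M \<rightarrow>\<^sub>M N"
proof (rule measurableI)
  fix A assume A: "A \<in> sets N"
  have g': "g \<in> completion M \<rightarrow>\<^sub>M N" using g by (rule measurable_completion)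
  have "Measurable.pred (completion M) (\<lambda>x. \<not> (f x \<in> A \<longleftrightarrow> g x \<in> A))"
    by (rule sets_completion_AE) (use ae in eventually_elim, auto)
  moreover have "Measurable.pred (completion M) (\<lambda>x. g x \<in> A)"
    using g' A by measurable
  \<comment> \<open>The set where membership of \<open>f x\<close> and of \<open>g x\<close> in
    \<open>A\<close> disagree is null, hence measurable in the completion. Its symmetric difference
    with the preimage under \<open>g\<close> is the preimage under \<open>f\<close>.\<close>
  ultimately have "Measurable.pred (completion M) (\<lambda>x. (g x \<in> A) \<noteq> (\<not> (f x \<in> A \<longleftrightarrow> g x \<in> A)))"
    by measurable
  then have "Measurable.pred (completion M) (\<lambda>x. f x \<in> A)"
    by (rule back_subst[where P="Measurable.pred (completion M)"]) auto
  then show "f -` A \<inter> space (completion M) \<in> sets (completion M)"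
    by (simp add: pred_def vimage_def Int_def conj_commute)
qed (use f in auto)

lemma integral_completion_AE:
  fixes g h :: "'a \<Rightarrow> 'b::{banach, second_countable_topology}"
  assumes g: "g \<in> borel_measurable M" and ae: "AE x in M. h x = g x"
  shows "(LINT x|completion M. h x) = (LINT x|M. g x)"
proof -
  have "(LINT x|completion M. h x) = (LINT x|completion M. g x)"
    using g ae
    by (intro integral_cong_AE AE_completion measurable_completion measurable_completion_AE[OF g ae]) auto
  also have "\<dots> = (LINT x|M. g x)"
    using g by (rule integral_completion)
  finally show ?thesis .
qed

text \<open>Averaging over rotations replaces integration in polar coordinates.\<close>

lemma integral_radial_weight_eq_0:
  fixes h g :: "complex \<Rightarrow> complex"
  assumes [measurable]: "g \<in> borel_measurable borel" and hg: "AE w in lborel. h w = g w"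
    and circ: "\<And>r. r > 0 \<Longrightarrow> (LINT w|circle_measure r. h w) = 0"
    and int: "integrable lborel (\<lambda>w. g w * \<phi> (cmod w))"
    and [measurable]: "\<phi> \<in> borel_measurable borel"
  shows "(LINT w|lborel. g w * \<phi> (cmod w)) = 0"
proof -
  interpret U: prob_space unif_angle by (rule prob_space_unif_angle)
  interpret P: pair_sigma_finite unif_angle "lborel :: complex measure" ..
  obtain N where N: "N \<in> null_sets lborel" and hgN: "\<And>w. w \<notin> N \<Longrightarrow> h w = g w"
    using hg by (elim AE_E) (force simp: null_sets_def)
  have [measurable]: "N \<in> sets borel" using N by auto
  define F where "F w = g w * \<phi> (cmod w)" for w
  have [measurable]: "F \<in> borel_measurable borel" unfolding F_def by measurable
  have intF: "integrable lborel F" using int by (simp add: F_def[abs_def])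
  have rot: "integrable lborel (\<lambda>w. F (cis t * w))" 
      "(LINT w|lborel. F (cis t * w)) = (LINT w|lborel. F w)"
      "(LINT w|lborel. norm (F (cis t * w))) = (LINT w|lborel. norm (F w))" for t
  proof -
    have "integrable (distr lborel borel (\<lambda>w. cis t * w)) F"
      unfolding distr_lborel_cis_mult by (rule intF)
    then show "integrable lborel (\<lambda>w. F (cis t * w))" 
      by (subst (asm) integrable_distr_eq) auto
    have "(LINT w|lborel. F w) = (LINT w|distr lborel borel (\<lambda>w. cis t * w). F w)"
      unfolding distr_lborel_cis_mult ..
    then show "(LINT w|lborel. F (cis t * w)) = (LINT w|lborel. F w)"
      by (subst (asm) integral_distr) auto
    have "(LINT w|lborel. norm (F w)) = (LINT w|distr lborel borel (\<lambda>w. cis t * w). norm (F w))"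
      unfolding distr_lborel_cis_mult ..
    then show "(LINT w|lborel. norm (F (cis t * w))) = (LINT w|lborel. norm (F w))"
      by (subst (asm) integral_distr) auto
  qed
  \<comment> \<open>Rotation invariance makes the integral of the norm over \<open>w\<close>
    independent of \<open>t\<close>, hence integrable against the finite measure of angles.\<close>
  have intP: "integrable (unif_angle \<Otimes>\<^sub>M lborel) (\<lambda>(t, w). F (cis t * w))"
    by (rule P.Fubini_integrable) (auto simp: rot)
  have zero: "AE w in lborel. (LINT t|unif_angle. F (cis t * w)) = 0"
    using AE_circle_null_set[OF N] AE_lborel_singleton[of 0]
  proof eventually_elim
    case (elim w)
    \<comment> \<open>The radial weight is constant along the circle through \<open>w\<close>, so
      only the circular mean of \<open>g\<close> remains.\<close>
    have "(LINT t|unif_angle. F (cis t * w)) = \<phi> (cmod w) * (LINT t|unif_angle. g (cis t * w))"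
      by (simp add: F_def norm_mult mult.commute)
    also have "(LINT t|unif_angle. g (cis t * w)) = (LINT z|circle (cmod w). g z)"
      unfolding distr_unif_angle_rotate[OF elim(2), symmetric] by (subst integral_distr) auto
    also have "\<dots> = (LINT z|circle_measure (cmod w). h z)"
      unfolding circle_measure_eq
      by (rule integral_completion_AE[symmetric])
        (use elim(1) hgN in \<open>auto elim!: eventually_mono\<close>)
    also have "\<dots> = 0"
      using circ[of "cmod w"] elim by simp
    finally show ?case by simp
  qed
  have "(LINT w|lborel. F w) = (LINT t|unif_angle. LINT w|lborel. F (cis t * w))"
    using U.prob_space by (simp add: rot)
  also have "\<dots> = (LINT w|lborel. LINT t|unif_angle. F (cis t * w))"
    using P.Fubini_integral[OF intP] by simp
  also have "\<dots> = 0"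
    using zero by (intro integral_eq_zero_AE)
  finally show ?thesis by (simp add: F_def)
qed

subsection \<open>Moments with Gaussian weights\<close>

lemma integrable_exp_minus_square:
  assumes "a > 0"
  shows "integrable lborel (\<lambda>x::real. exp (- a * x\<^sup>2))"
proof -
  \<comment> \<open>Variance 1 / (2 a) makes the exponent of the normal density equal to - a x^2;
    the square root cancels the normalization.\<close>
  have "integrable lborel (\<lambda>x. sqrt (2 * pi * (1 / (2 * a))) * normal_density 0 (sqrt (1 / (2 * a))) x)"
    by (intro integrable_mult_right integrable_normal_density) (use assms in auto)
  also have "(\<lambda>x. sqrt (2 * pi * (1 / (2 * a))) * normal_density 0 (sqrt (1 / (2 * a))) x) = (\<lambda>x. exp (- a * x\<^sup>2))"
    using assms by (auto simp: normal_density_def field_simps)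
  finally show ?thesis .
qed

lemma integrable_complex_gaussian:
  assumes "a > 0"
  shows "integrable lborel (\<lambda>z::complex. exp (- a * (cmod z)\<^sup>2))"
proof (rule integrableI_nonneg)
  have "(\<integral>\<^sup>+z. ennreal (exp (- a * (cmod z)\<^sup>2)) \<partial>lborel)
      = (\<integral>\<^sup>+z. (\<Prod>b\<in>Basis. ennreal (exp (- a * (z \<bullet> b)\<^sup>2))) \<partial>(lborel :: complex measure))"
    by (simp add: Basis_complex_def ennreal_mult[symmetric] exp_add[symmetric] cmod_power2 algebra_simps)
  also have "\<dots> = (\<Prod>b\<in>(Basis :: complex set). (\<integral>\<^sup>+x. ennreal (exp (- a * x\<^sup>2)) \<partial>lborel))"
    by (rule nn_integral_lborel_prod) auto
  also have "\<dots> < \<infinity>"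
    using integrable_exp_minus_square[OF assms]
    by (subst nn_integral_eq_integral) (auto simp: Basis_complex_def ennreal_mult[symmetric])
  finally show "(\<integral>\<^sup>+z. ennreal (exp (- a * (cmod z)\<^sup>2)) \<partial>lborel) < \<infinity>" .
qed auto

text \<open>Completing the square: half of the quadratic decay absorbs the linear term, at the cost
  of the constant \<open>exp (C\<^sup>2 / (2 * a))\<close>.\<close>

lemma exp_linear_le_exp_square:
  fixes C a :: real
  assumes "a > 0"
  obtains K where "\<And>x. exp (C * x - a * x\<^sup>2) \<le> K * exp (- (a / 2) * x\<^sup>2)" "K > 0"
proof
  fix x :: real
  have "0 \<le> (a * x - C)\<^sup>2 / (2 * a)" using assms by simp
  also have "\<dots> = a / 2 * x\<^sup>2 - C * x + C\<^sup>2 / (2 * a)"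
    using assms by (simp add: power2_diff field_simps power2_eq_square)
  finally show "exp (C * x - a * x\<^sup>2) \<le> exp (C\<^sup>2 / (2 * a)) * exp (- (a / 2) * x\<^sup>2)"
    by (simp add: exp_add[symmetric])
qed simp

lemma power_le_fact_exp:
  fixes x :: real
  assumes "x \<ge> 0"
  shows "x ^ n \<le> fact n * exp x"
proof -
  have "(\<Sum>i\<in>{n}. x ^ i /\<^sub>R fact i) \<le> (\<Sum>i. x ^ i /\<^sub>R fact i)"
    using assms by (intro sum_le_suminf sums_summable[OF exp_converges]) auto
  also have "\<dots> = exp x"
    using exp_converges[of x] by (rule sums_unique[symmetric])
  finally have "x ^ n / fact n \<le> exp x" by (simp add: field_simps)
  then show ?thesis by (simp add: field_simps)
qed

text \<open>The product is bounded by half of |f|^2 + |g|^2, and the growth condition bounds |g|^2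
  by a multiple of a Gaussian.\<close>

lemma integrable_square_integrable_gaussian:
  fixes f g :: "complex \<Rightarrow> complex"
  assumes [measurable]: "f \<in> borel_measurable borel" "g \<in> borel_measurable borel"
    and f: "integrable lborel (\<lambda>z. (cmod (f z))\<^sup>2)"
    and a: "a > 0" and g: "\<And>z. cmod (g z) \<le> B * exp (C * cmod z - a * (cmod z)\<^sup>2)"
  shows "integrable lborel (\<lambda>z. f z * g z)"
proof -
  obtain K where K: "\<And>x. exp (2 * C * x - 2 * a * x\<^sup>2) \<le> K * exp (- (2 * a / 2) * x\<^sup>2)"
    using exp_linear_le_exp_square[of "2 * a" "2 * C"] a by auto
  show ?thesis
  proof (rule Bochner_Integration.integrable_bound)
    show "integrable lborel (\<lambda>z. ((cmod (f z))\<^sup>2 + B\<^sup>2 * K * exp (- (2 * a / 2) * (cmod z)\<^sup>2)) / 2)"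
      using f integrable_complex_gaussian[of "2 * a / 2"] a by auto
    have "norm (f z * g z) \<le> norm (((cmod (f z))\<^sup>2 + B\<^sup>2 * K * exp (- (2 * a / 2) * (cmod z)\<^sup>2)) / 2)" for z
    proof -
      have "(cmod (g z))\<^sup>2 \<le> (B * exp (C * cmod z - a * (cmod z)\<^sup>2))\<^sup>2"
        by (intro power_mono g) auto
      also have "\<dots> = B\<^sup>2 * exp (2 * C * cmod z - 2 * a * (cmod z)\<^sup>2)"
        by (simp add: power_mult_distrib exp_double[symmetric] algebra_simps)
      also have "\<dots> \<le> B\<^sup>2 * (K * exp (- (2 * a / 2) * (cmod z)\<^sup>2))"
        by (intro mult_left_mono K) auto
      finally have "(cmod (g z))\<^sup>2 \<le> B\<^sup>2 * K * exp (- (2 * a / 2) * (cmod z)\<^sup>2)" by simp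
      moreover have "2 * (cmod (f z) * cmod (g z)) \<le> (cmod (f z))\<^sup>2 + (cmod (g z))\<^sup>2"
        using sum_squares_bound[of "cmod (f z)" "cmod (g z)"] by simp
      ultimately show ?thesis by (simp add: norm_mult)
    qed
    then show "AE z in lborel. norm (f z * g z) \<le> norm (((cmod (f z))\<^sup>2 + B\<^sup>2 * K * exp (- (2 * a / 2) * (cmod z)\<^sup>2)) / 2)"
      by simp
  qed measurable
qed

section \<open>Termwise integration of exponential series\<close>

lemma integral_sums_dominated:
  fixes u :: "nat \<Rightarrow> 'a \<Rightarrow> 'b::{banach, second_countable_topology}"
  assumes meas: "\<And>i. u i \<in> borel_measurable M" "U \<in> borel_measurable M"
    and sums: "\<And>x. (\<lambda>i. u i x) sums U x"
    and dom: "\<And>n x. (\<Sum>i<n. norm (u i x)) \<le> K x" and K: "integrable M K"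
  shows "(\<lambda>i. integral\<^sup>L M (u i)) sums integral\<^sup>L M U"
proof -
  have lim: "(\<lambda>n. \<Sum>i<n. u i x) \<longlonglongrightarrow> U x" for x
    using sums by (simp add: sums_def)
  have le: "norm (\<Sum>i<n. u i x) \<le> K x" for n x
    using norm_sum[of "\<lambda>i. u i x" "{..<n}"] dom[where n = n and x = x] by simp
  have m: "(\<lambda>x. \<Sum>i<n. u i x) \<in> borel_measurable M" for n
    using meas by measurable
  have int: "integrable M (u i)" for i
  proof (rule Bochner_Integration.integrable_bound[OF K])
    have "norm (u i x) \<le> norm (K x)" for x
    proof -
      have "norm (u i x) \<le> (\<Sum>i<Suc i. norm (u i x))"
        by (simp add: sum_nonneg)
      also have "\<dots> \<le> norm (K x)" using dom[where n = "Suc i" and x = x] by simp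
      finally show ?thesis .
    qed
    then show "AE x in M. norm (u i x) \<le> norm (K x)" by simp
  qed (rule meas)
  have "(\<lambda>n. integral\<^sup>L M (\<lambda>x. \<Sum>i<n. u i x)) \<longlonglongrightarrow> integral\<^sup>L M U"
    by (rule integral_dominated_convergence[where s = "\<lambda>n x. \<Sum>i<n. u i x", OF meas(2) m K]) (use lim le in auto)
  with int show "(\<lambda>i. integral\<^sup>L M (u i)) sums integral\<^sup>L M U"
    by (simp add: sums_def)
qed

text \<open>All partial sums of the norms are at most |H| exp |a|, so dominated convergence applies
  as soon as this bound is integrable.\<close>

lemma integral_exp_series:
  fixes H a :: "'a \<Rightarrow> complex"
  assumes [measurable]: "H \<in> borel_measurable M" "a \<in> borel_measurable M"
    and int: "integrable M (\<lambda>w. H w * complex_of_real (exp (cmod (a w))))"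
  shows "(\<lambda>n. LINT w|M. H w * (a w ^ n / fact n)) sums (LINT w|M. H w * exp (a w))"
proof -
  have K: "integrable M (\<lambda>w. norm (H w) * exp (cmod (a w)))"
    using integrable_norm[OF int] by (simp add: norm_mult)
  have sums: "(\<lambda>n. H w * (a w ^ n / fact n)) sums (H w * exp (a w))" for w
    using exp_converges[of "a w"]
    by (intro sums_mult) (simp add: scaleR_conv_of_real divide_inverse mult.commute)
  have dom: "(\<Sum>i<n. norm (H w * (a w ^ i / fact i))) \<le> norm (H w) * exp (cmod (a w))" for n w
  proof -
    have "(\<Sum>i<n. cmod (a w) ^ i /\<^sub>R fact i) \<le> (\<Sum>i. cmod (a w) ^ i /\<^sub>R fact i)"
      by (intro sum_le_suminf sums_summable[OF exp_converges]) auto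
    also have "\<dots> = exp (cmod (a w))"
      using exp_converges[of "cmod (a w)"] by (rule sums_unique[symmetric])
    finally have "norm (H w) * (\<Sum>i<n. cmod (a w) ^ i /\<^sub>R fact i) \<le> norm (H w) * exp (cmod (a w))"
      by (rule mult_left_mono) simp
    then show ?thesis
      by (simp add: sum_distrib_left norm_mult norm_divide norm_power norm_inverse divide_inverse mult_ac)
  qed
  have m: "(\<lambda>w. H w * (a w ^ n / fact n)) \<in> borel_measurable M" for n by measurable
  have m': "(\<lambda>w. H w * exp (a w)) \<in> borel_measurable M" by measurable
  show ?thesis
    by (rule integral_sums_dominated[OF m m' sums dom K])
qed

definition gauss_moment :: "(complex \<Rightarrow> complex) \<Rightarrow> real \<Rightarrow> nat \<Rightarrow> nat \<Rightarrow> complex" where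
  "gauss_moment f s p q =
     (LINT w|lborel. f w * (complex_of_real (exp (- s * (cmod w)\<^sup>2)) * w ^ p * cnj w ^ q))"

lemma measurable_cnj [measurable]: "cnj \<in> borel \<rightarrow>\<^sub>M borel"
  by (intro borel_measurable_continuous_onI continuous_intros)

locale L2_borel =
  fixes f :: "complex \<Rightarrow> complex"
  assumes meas [measurable]: "f \<in> borel_measurable borel"
    and L2: "integrable lborel (\<lambda>z. (cmod (f z))\<^sup>2)"
begin

lemma integrable_gauss:
  assumes [measurable]: "h \<in> borel_measurable borel"
    and "s > 0" and h: "\<And>w. cmod (h w) \<le> B * exp (C * cmod w)"
  shows "integrable lborel (\<lambda>w. f w * (complex_of_real (exp (- s * (cmod w)\<^sup>2)) * h w))"
proof (rule integrable_square_integrable_gaussian[where B = B and C = C and a = s])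
  fix z
  have "exp (- s * (cmod z)\<^sup>2) * cmod (h z) \<le> exp (- s * (cmod z)\<^sup>2) * (B * exp (C * cmod z))"
    by (intro mult_left_mono h) auto
  also have "\<dots> = B * exp (C * cmod z - s * (cmod z)\<^sup>2)"
    by (simp add: exp_add[symmetric] mult_ac)
  finally show "cmod (complex_of_real (exp (- s * (cmod z)\<^sup>2)) * h z) \<le> B * exp (C * cmod z - s * (cmod z)\<^sup>2)"
    by (simp add: norm_mult)
qed (use meas L2 \<open>s > 0\<close> in auto)

lemma cmod_monomial_le: "cmod (w ^ p * cnj w ^ q) \<le> fact (p + q) * exp (cmod w)"
  using power_le_fact_exp[of "cmod w" "p + q"] by (simp add: norm_mult norm_power power_add)

text \<open>The increment s / 2 stays below \<open>s\<close>: the series of exp (- (s / 2) |w|^2) is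
  dominated by exp ((s / 2) |w|^2), and the product with the weight of rate \<open>s\<close> still
  decays like a Gaussian of rate s / 2. Each term of the series is a multiple of a moment of rate
  \<open>s\<close>.\<close>

lemma gauss_moment_step:
  assumes s: "s > 0" and zero: "\<And>p q. gauss_moment f s p q = 0"
  shows "gauss_moment f (3 / 2 * s) p q = 0"
proof -
  define H where "H w = f w * (complex_of_real (exp (- s * (cmod w)\<^sup>2)) * (w ^ p * cnj w ^ q))" for w
  define a where "a w = complex_of_real (- (s / 2)) * (w * cnj w)" for w
  have [measurable]: "H \<in> borel_measurable borel" "a \<in> borel_measurable borel"
    unfolding H_def a_def by measurable
  have "integrable lborel (\<lambda>w. f w * (complex_of_real (exp (- (s / 2) * (cmod w)\<^sup>2)) * (w ^ p * cnj w ^ q)))"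
    by (rule integrable_gauss[where C = 1]) (use cmod_monomial_le s in auto)
  also have "(\<lambda>w. f w * (complex_of_real (exp (- (s / 2) * (cmod w)\<^sup>2)) * (w ^ p * cnj w ^ q)))
      = (\<lambda>w. H w * complex_of_real (exp (cmod (a w))))"
  proof
    fix w
    have "exp (- (s / 2) * (cmod w)\<^sup>2) = exp (- s * (cmod w)\<^sup>2) * exp (cmod (a w))"
      using s by (simp add: exp_add[symmetric] a_def norm_mult power2_eq_square)
    then show "f w * (complex_of_real (exp (- (s / 2) * (cmod w)\<^sup>2)) * (w ^ p * cnj w ^ q))
      = H w * complex_of_real (exp (cmod (a w)))"
      by (simp add: H_def mult_ac)
  qed
  finally have "(\<lambda>n. LINT w|lborel. H w * (a w ^ n / fact n)) sums (LINT w|lborel. H w * exp (a w))"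
    by (intro integral_exp_series) auto
  moreover have "(LINT w|lborel. H w * (a w ^ n / fact n)) = 0" for n
  proof -
    have "(LINT w|lborel. H w * (a w ^ n / fact n))
      = complex_of_real (- (s / 2)) ^ n / fact n * gauss_moment f s (p + n) (q + n)"
    proof -
      have "a w ^ n = complex_of_real (- (s / 2)) ^ n * (w ^ n * cnj w ^ n)" for w
        by (simp only: a_def power_mult_distrib)
      then show ?thesis
        unfolding gauss_moment_def integral_mult_right_zero[symmetric]
        by (intro Bochner_Integration.integral_cong) (simp_all add: H_def power_add mult_ac)
    qed
    then show ?thesis by (simp add: zero)
  qed
  ultimately have "(LINT w|lborel. H w * exp (a w)) = 0"
    by (auto dest!: sums_unique)
  moreover have "H w * exp (a w) = f w * (complex_of_real (exp (- (3 / 2 * s) * (cmod w)\<^sup>2)) * w ^ p * cnj w ^ q)" for w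
  proof -
    have "exp (a w) = complex_of_real (exp (- (s / 2) * (cmod w)\<^sup>2))"
      by (simp add: a_def complex_norm_square[symmetric] exp_of_real[symmetric])
    moreover have "exp (- (3 / 2 * s) * (cmod w)\<^sup>2) = exp (- s * (cmod w)\<^sup>2) * exp (- (s / 2) * (cmod w)\<^sup>2)"
      by (simp add: exp_add[symmetric] field_simps)
    ultimately show ?thesis by (simp add: H_def mult_ac)
  qed
  ultimately show ?thesis by (simp add: gauss_moment_def)
qed

text \<open>Iterating the step makes the rates grow geometrically, hence without bound.\<close>

lemma gauss_moment_all:
  assumes zero: "\<And>p q. gauss_moment f (1 / 4) p q = 0"
  shows "gauss_moment f ((3 / 2) ^ n / 4) p q = 0"
proof (induction n arbitrary: p q)
  case 0
  then show ?case using zero by simp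
next
  case (Suc n)
  have "gauss_moment f (3 / 2 * ((3 / 2) ^ n / 4)) p q = 0"
    by (rule gauss_moment_step) (use Suc in auto)
  then show ?case by simp
qed

text \<open>The exponential is expanded in powers of its linear exponent, and the binomial theorem
  turns each power into a combination of monomials in \<open>w\<close> and \<open>cnj w\<close>,
  that is, of moments.\<close>

lemma integral_gauss_linear:
  assumes s: "s > 0" and zero: "\<And>p q. gauss_moment f s p q = 0"
  shows "(LINT w|lborel. f w * (complex_of_real (exp (- s * (cmod w)\<^sup>2)) * exp (u * w + v * cnj w))) = 0"
proof -
  define H where "H w = f w * complex_of_real (exp (- s * (cmod w)\<^sup>2))" for w
  define a where "a w = u * w + v * cnj w" for w
  have [measurable]: "H \<in> borel_measurable borel" "a \<in> borel_measurable borel"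
    unfolding H_def a_def by measurable
  have bound: "cmod (complex_of_real (exp (cmod (a w)))) \<le> 1 * exp ((cmod u + cmod v) * cmod w)" for w
    using norm_triangle_ineq[of "u * w" "v * cnj w"] by (simp add: a_def norm_mult algebra_simps)
  have int: "integrable lborel (\<lambda>w. H w * complex_of_real (exp (cmod (a w))))"
    using integrable_gauss[OF _ s bound] by (simp add: H_def mult_ac)
  have gm_int: "integrable lborel (\<lambda>w. f w * (complex_of_real (exp (- s * (cmod w)\<^sup>2)) * (w ^ p * cnj w ^ q)))" for p q
    by (rule integrable_gauss[where C = 1]) (use cmod_monomial_le s in auto)
  have "(LINT w|lborel. H w * (a w ^ n / fact n)) = 0" for n
  proof -
    have "(LINT w|lborel. H w * (a w ^ n / fact n)) =
      (LINT w|lborel. (\<Sum>k\<le>n. of_nat (n choose k) * u ^ k * v ^ (n - k) / fact n *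
        (f w * (complex_of_real (exp (- s * (cmod w)\<^sup>2)) * (w ^ k * cnj w ^ (n - k))))))"
      by (rule Bochner_Integration.integral_cong)
        (simp_all add: H_def a_def binomial_ring power_mult_distrib sum_distrib_left sum_divide_distrib mult_ac)
    also have "\<dots> = (\<Sum>k\<le>n. of_nat (n choose k) * u ^ k * v ^ (n - k) / fact n * gauss_moment f s k (n - k))"
      using gm_int by (simp add: gauss_moment_def mult.assoc)
    finally show ?thesis by (simp add: zero)
  qed
  with integral_exp_series[OF _ _ int] have "(LINT w|lborel. H w * exp (a w)) = 0"
    by (auto dest!: sums_unique)
  then show ?thesis by (simp add: H_def a_def mult_ac)
qed

text \<open>Since |w - y|^2 = |w|^2 + |y|^2 - cnj(y) w - y cnj(w), the product of the two Gaussians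
  is a constant times a centred Gaussian of rate 1/4 + l times the exponential of a linear
  form.\<close>

lemma integral_shifted_gauss:
  assumes zero: "\<And>p q. gauss_moment f (1 / 4 + l) p q = 0" and "l > 0"
  shows "(LINT w|lborel. f w * complex_of_real (exp (- (cmod w)\<^sup>2 / 4)) * complex_of_real (exp (- l * (cmod (w - y))\<^sup>2))) = 0"
proof -
  have "complex_of_real (exp (- (cmod w)\<^sup>2 / 4)) * complex_of_real (exp (- l * (cmod (w - y))\<^sup>2))
     = complex_of_real (exp (- l * (cmod y)\<^sup>2)) * (complex_of_real (exp (- (1 / 4 + l) * (cmod w)\<^sup>2)) * exp (of_real l * cnj y * w + of_real l * y * cnj w))" for w
  proof -
    have "complex_of_real ((cmod (w - y))\<^sup>2) = of_real ((cmod w)\<^sup>2) + of_real ((cmod y)\<^sup>2) - cnj y * w - y * cnj w" (is "?X = ?Y")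
      by (simp only: complex_norm_square) (simp add: algebra_simps)
    then have eq: "?X = ?Y" .
    have "- (complex_of_real ((cmod w)\<^sup>2) / 4) - of_real l * complex_of_real ((cmod (w - y))\<^sup>2)
      = - of_real l * of_real ((cmod y)\<^sup>2) + (- (1 / 4 + of_real l) * of_real ((cmod w)\<^sup>2) + (of_real l * cnj y * w + of_real l * y * cnj w))"
      by (simp only: eq) (simp add: algebra_simps)
    then have "exp (- (complex_of_real ((cmod w)\<^sup>2) / 4) - of_real l * complex_of_real ((cmod (w - y))\<^sup>2))
      = exp (- of_real l * of_real ((cmod y)\<^sup>2)) * (exp (- (1 / 4 + of_real l) * of_real ((cmod w)\<^sup>2)) * exp (of_real l * cnj y * w + of_real l * y * cnj w))"
      by (simp only: exp_add[symmetric])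
    then show ?thesis
      by (simp add: exp_of_real[symmetric] exp_add[symmetric])
  qed
  then have "(LINT w|lborel. f w * complex_of_real (exp (- (cmod w)\<^sup>2 / 4)) * complex_of_real (exp (- l * (cmod (w - y))\<^sup>2)))
    = (LINT w|lborel. complex_of_real (exp (- l * (cmod y)\<^sup>2)) * (f w * (complex_of_real (exp (- (1 / 4 + l) * (cmod w)\<^sup>2)) * exp (of_real l * cnj y * w + of_real l * y * cnj w))))"
    by (intro Bochner_Integration.integral_cong refl) (simp only: mult.assoc mult.left_commute[of "f _"])
  also have "\<dots> = 0"
    using integral_gauss_linear[OF _ zero] \<open>l > 0\<close> by simp
  finally show ?thesis .
qed

end

section \<open>Uniqueness from integrals over boxes and against narrow Gaussians\<close>

lemma AE_zero_if_integral_box_zero_real: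
  fixes u :: "'a::euclidean_space \<Rightarrow> real"
  assumes u: "integrable lborel u"
    and zero: "\<And>a b. (LINT x|lborel. indicator (box a b) x * u x) = 0"
  shows "AE x in lborel. u x = 0"
proof -
  have [measurable]: "u \<in> borel_measurable borel" using borel_measurable_integrable[OF u] by simp
  have int: "integrable lborel (\<lambda>x. max 0 (u x))" "integrable lborel (\<lambda>x. max 0 (- u x))"
    using u by auto
  \<comment> \<open>The positive and negative parts of \<open>u\<close> serve as densities of two
    finite measures. These agree on boxes, an intersection-stable generator, so they are equal;
    hence so are the two parts, almost everywhere, and both must then be zero.\<close>
  define M N where "M = density lborel (\<lambda>x. ennreal (max 0 (u x)))"
    and "N = density lborel (\<lambda>x. ennreal (max 0 (- u x)))"
  have fin: "emeasure M A < \<infinity>" if "A \<in> sets borel" for A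
  proof -
    have "emeasure M A \<le> emeasure M UNIV" using that by (intro emeasure_mono) (auto simp: M_def)
    also have "\<dots> = (\<integral>\<^sup>+x. ennreal (max 0 (u x)) \<partial>lborel)"
      by (simp add: M_def emeasure_density)
    also have "\<dots> < \<infinity>"
      by (subst nn_integral_eq_integral[OF int(1)]) auto
    finally show ?thesis .
  qed
  have "M = N"
  proof (rule measure_eqI_generator_eq)
    let ?E = "range (\<lambda>(a, b). box a b :: 'a set)"
    show "Int_stable ?E"
      by (auto simp: Int_stable_def box_Int_box)
    show "?E \<subseteq> Pow UNIV" "sets M = sigma_sets UNIV ?E" "sets N = sigma_sets UNIV ?E"
      by (simp_all add: borel_eq_box M_def N_def)
    let ?A = "\<lambda>n::nat. box (- (real n *\<^sub>R One)) (real n *\<^sub>R One) :: 'a set"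
    show "range ?A \<subseteq> ?E" "(\<Union>i. ?A i) = UNIV"
      unfolding UN_box_eq_UNIV by auto
    show "emeasure M (?A i) \<noteq> \<infinity>" for i using fin[of "?A i"] by auto
    fix X assume "X \<in> ?E"
    then obtain a b where X: "X = box a b" by auto
    have i1: "integrable lborel (\<lambda>x. indicator X x * max 0 (u x))" 
      and i2: "integrable lborel (\<lambda>x. indicator X x * max 0 (- u x))"
      using integrable_real_mult_indicator[OF _ int(1), of X] integrable_real_mult_indicator[OF _ int(2), of X] X
      by (auto simp: mult.commute)
    have "(LINT x|lborel. indicator X x * max 0 (u x)) - (LINT x|lborel. indicator X x * max 0 (- u x))
      = (LINT x|lborel. indicator X x * max 0 (u x) - indicator X x * max 0 (- u x))"
      using i1 i2 by simp
    also have "\<dots> = (LINT x|lborel. indicator X x * u x)"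
      by (rule Bochner_Integration.integral_cong) (auto simp: max_def indicator_def)
    also have "\<dots> = 0" using zero X by simp
    finally have eq: "(LINT x|lborel. indicator X x * max 0 (u x)) = (LINT x|lborel. indicator X x * max 0 (- u x))"
      by simp
    have "emeasure M X = (\<integral>\<^sup>+x. ennreal (indicator X x * max 0 (u x)) \<partial>lborel)"
      using X by (auto simp: M_def emeasure_density intro!: nn_integral_cong split: split_indicator)
    also have "\<dots> = (\<integral>\<^sup>+x. ennreal (indicator X x * max 0 (- u x)) \<partial>lborel)"
      using i1 i2 eq by (subst (1 2) nn_integral_eq_integral) auto
    also have "\<dots> = emeasure N X"
      using X by (auto simp: N_def emeasure_density intro!: nn_integral_cong split: split_indicator)
    finally show "emeasure M X = emeasure N X" .
  qed
  then have "AE x in lborel. ennreal (max 0 (u x)) = ennreal (max 0 (- u x))"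
    unfolding M_def N_def
    by (intro sigma_finite_measure.density_unique[OF sigma_finite_lborel]) auto
  then show ?thesis
    by eventually_elim (auto simp: max_def split: if_splits)
qed

lemma AE_zero_if_integral_box_zero:
  fixes u :: "'a::euclidean_space \<Rightarrow> complex"
  assumes u: "integrable lborel u"
    and zero: "\<And>a b. (LINT x|lborel. complex_of_real (indicator (box a b) x) * u x) = 0"
  shows "AE x in lborel. u x = 0"
proof -
  have int: "integrable lborel (\<lambda>x. complex_of_real (indicator (box a b) x) * u x)" for a b
    using integrable_mult_indicator[OF _ u, of "box a b"] by (simp add: scaleR_conv_of_real)
  have "AE x in lborel. Re (u x) = 0"
  proof (rule AE_zero_if_integral_box_zero_real)
    show "(LINT x|lborel. indicator (box a b) x * Re (u x)) = 0" for a b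
      using integral_Re[OF int[of a b]] zero[of a b] by simp
  qed (use u in auto)
  moreover have "AE x in lborel. Im (u x) = 0"
  proof (rule AE_zero_if_integral_box_zero_real)
    show "(LINT x|lborel. indicator (box a b) x * Im (u x)) = 0" for a b
      using integral_Im[OF int[of a b]] zero[of a b] by simp
  qed (use u in auto)
  ultimately show ?thesis
    by eventually_elim (simp add: complex_eq_iff)
qed

lemma integral_lborel_affine_complex:
  fixes F :: "complex \<Rightarrow> 'b::{banach, second_countable_topology}"
  assumes [measurable]: "F \<in> borel_measurable borel" and "c \<noteq> 0"
  shows "(LINT y|lborel. F y) = c\<^sup>2 *\<^sub>R (LINT v|lborel. F (w + c *\<^sub>R v))"
  using \<open>c \<noteq> 0\<close>
  by (subst lborel_affine[of c w])
    (simp_all add: integral_density integral_distr)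

text \<open>Off the boundary the indicator of the box is locally constant, so for each fixed
  \<open>v\<close> the integrand is eventually constant in \<open>n\<close>. The Gaussian
  dominates.\<close>

lemma gauss_smoothed_box_limit:
  fixes a b w :: complex and l :: "nat \<Rightarrow> real"
  assumes l: "filterlim l at_top sequentially" and lpos: "\<And>n. l n > 0"
    and w: "w \<notin> cbox a b - box a b"
  shows "(\<lambda>n. LINT v|lborel. indicator (box a b) (w + (1 / sqrt (l n)) *\<^sub>R v) * exp (- (cmod v)\<^sup>2))
    \<longlonglongrightarrow> indicator (box a b) w * (LINT v|lborel. exp (- (cmod v)\<^sup>2))"
proof -
  have lim0: "(\<lambda>n. 1 / sqrt (l n)) \<longlonglongrightarrow> 0"
    using l by (intro tendsto_divide_0[OF tendsto_const] filterlim_at_top_imp_at_infinity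
        filterlim_compose[OF sqrt_at_top])
  have ev: "eventually (\<lambda>n. indicator (box a b) (w + (1 / sqrt (l n)) *\<^sub>R v) = (indicator (box a b) w :: real)) sequentially" for v
  proof -
    have lim: "(\<lambda>n. w + (1 / sqrt (l n)) *\<^sub>R v) \<longlonglongrightarrow> w"
      using tendsto_add[OF tendsto_const[of w] tendsto_scaleR[OF lim0 tendsto_const[of v]]] by simp
    show ?thesis
    proof (cases "w \<in> box a b")
      case True
      have "eventually (\<lambda>n. w + (1 / sqrt (l n)) *\<^sub>R v \<in> box a b) sequentially"
        by (rule topological_tendstoD[OF lim open_box True])
      then show ?thesis using True by (auto elim!: eventually_mono)
    next
      case False
      then have "w \<in> - cbox a b" using w by auto
      then have "eventually (\<lambda>n. w + (1 / sqrt (l n)) *\<^sub>R v \<in> - cbox a b) sequentially"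
        by (intro topological_tendstoD[OF lim]) (auto intro: closed_cbox)
      then show ?thesis using False box_subset_cbox[of a b]
        by (auto simp: indicator_def elim!: eventually_mono)
    qed
  qed
  have "(\<lambda>n. LINT v|lborel. indicator (box a b) (w + (1 / sqrt (l n)) *\<^sub>R v) * exp (- (cmod v)\<^sup>2))
    \<longlonglongrightarrow> (LINT v|lborel. indicator (box a b) w * exp (- (cmod v)\<^sup>2))"
  proof (rule integral_dominated_convergence[where w = "\<lambda>v. exp (- (cmod v)\<^sup>2)"])
    show "integrable lborel (\<lambda>v::complex. exp (- (cmod v)\<^sup>2))"
      using integrable_complex_gaussian[of 1] by simp
    show "AE v in lborel. (\<lambda>n. indicator (box a b) (w + (1 / sqrt (l n)) *\<^sub>R v) * exp (- (cmod v)\<^sup>2))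
       \<longlonglongrightarrow> indicator (box a b) w * exp (- (cmod v)\<^sup>2)"
      by (intro AE_I2 tendsto_mult tendsto_const tendsto_eventually ev)
  qed (auto simp: indicator_def)
  then show ?thesis by simp
qed

text \<open>Integrating the hypothesis over \<open>y\<close> in a box and exchanging integrals shows
  that \<open>g\<close> is orthogonal to smoothed indicators of the box. As the Gaussians get
  narrower these tend to a positive multiple of the indicator itself.\<close>

lemma AE_zero_if_gauss_zero:
  fixes g :: "complex \<Rightarrow> complex" and l :: "nat \<Rightarrow> real"
  assumes g: "integrable lborel g"
    and l: "filterlim l at_top sequentially" and lpos: "\<And>n. l n > 0"
    and zero: "\<And>n y. (LINT w|lborel. g w * complex_of_real (exp (- l n * (cmod (w - y))\<^sup>2))) = 0"
  shows "AE w in lborel. g w = 0"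
proof (rule AE_zero_if_integral_box_zero[OF g])
  fix a b :: complex
  have [measurable]: "g \<in> borel_measurable borel" using borel_measurable_integrable[OF g] by simp
  \<comment> \<open>The indicator smoothed by a Gaussian of rate \<open>l n\<close>, up to the
    factor \<open>1 / l n\<close>, after the substitution y = w + v / sqrt (l n).\<close>
  define k where "k n w = (LINT v|lborel. indicator (box a b) (w + (1 / sqrt (l n)) *\<^sub>R v) * exp (- (cmod v)\<^sup>2))" for n w
  define m where "m = (LINT v|lborel. exp (- (cmod (v :: complex))\<^sup>2))"
  have gauss: "integrable lborel (\<lambda>v::complex. exp (- (cmod v)\<^sup>2))"
    using integrable_complex_gaussian[of 1] by simp
  have mpos: "m > 0"
  proof -
    have "m \<noteq> 0"
    proof
      assume "m = 0"
      then have "AE v in (lborel :: complex measure). exp (- (cmod v)\<^sup>2) = 0"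
        using integral_nonneg_eq_0_iff_AE[OF gauss] by (simp add: m_def)
      then have "AE v in (lborel :: complex measure). False" by simp
      then show False by (simp add: ae_filter_eq_bot_iff trivial_limit_def[symmetric])
    qed
    moreover have "m \<ge> 0" unfolding m_def by (rule integral_nonneg_AE) simp
    ultimately show ?thesis by simp
  qed
  have [measurable]: "k n \<in> borel_measurable borel" for n
    unfolding k_def by measurable
  have k_le: "\<bar>k n w\<bar> \<le> m" for n w
  proof -
    have i: "integrable lborel (\<lambda>v. indicator (box a b) (w + (1 / sqrt (l n)) *\<^sub>R v) * exp (- (cmod v)\<^sup>2))"
      by (rule Bochner_Integration.integrable_bound[OF gauss]) (auto simp: indicator_def)
    have "0 \<le> k n w" unfolding k_def by (rule integral_nonneg_AE) simp
    moreover have "k n w \<le> m" unfolding k_def m_def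
      by (rule integral_mono[OF i gauss]) (auto simp: indicator_def)
    ultimately show ?thesis by simp
  qed
  have "(LINT w|lborel. g w * complex_of_real (k n w)) = 0" for n
  proof -
    define F where "F w y = g w * complex_of_real (indicator (box a b) y * exp (- l n * (cmod (w - y))\<^sup>2))" for w y
    have [measurable]: "(\<lambda>(w, y). F w y) \<in> borel_measurable (lborel \<Otimes>\<^sub>M lborel)"
      unfolding F_def by measurable
    have box: "integrable lborel (\<lambda>y. complex_of_real (indicator (box a b) y))"
      using emeasure_lborel_box_finite[of a b] by (intro integrable_of_real integrable_real_indicator) auto
    have intP: "integrable (lborel \<Otimes>\<^sub>M lborel) (\<lambda>(w, y). F w y)"
    proof (rule Bochner_Integration.integrable_bound)
      show "integrable (lborel \<Otimes>\<^sub>M lborel) (\<lambda>(w, y). g w * complex_of_real (indicator (box a b) y))"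
        using box g by (intro lborel_pair.Fubini_integrable) (auto simp: norm_mult)
      have "norm (F w y) \<le> norm (g w * complex_of_real (indicator (box a b) y))" for w y
        using lpos[of n] by (auto simp: F_def norm_mult indicator_def intro!: mult_left_le)
      then show "AE x in lborel \<Otimes>\<^sub>M lborel. norm (case x of (w, y) \<Rightarrow> F w y)
         \<le> norm (case x of (w, y) \<Rightarrow> g w * complex_of_real (indicator (box a b) y))"
        by auto
    qed simp
    have "(LINT w|lborel. F w y) = 0" for y
    proof -
      have "(LINT w|lborel. F w y) = (LINT w|lborel. complex_of_real (indicator (box a b) y) *
          (g w * complex_of_real (exp (- l n * (cmod (w - y))\<^sup>2))))"
        by (rule Bochner_Integration.integral_cong) (auto simp: F_def)
      also have "\<dots> = 0" by (simp only: integral_mult_right_zero zero mult_zero_right)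
      finally show ?thesis .
    qed
    then have "(LINT w|lborel. LINT y|lborel. F w y) = 0"
      using lborel_pair.Fubini_integral[OF intP] by simp
    moreover have "(LINT y|lborel. F w y) = complex_of_real (1 / l n) * (g w * complex_of_real (k n w))" for w
    proof -
      have "(LINT y|lborel. F w y) = g w * complex_of_real (LINT y|lborel. indicator (box a b) y * exp (- l n * (cmod (w - y))\<^sup>2))"
        unfolding F_def by (simp only: integral_mult_right_zero integral_complex_of_real)
      also have "(LINT y|lborel. indicator (box a b) y * exp (- l n * (cmod (w - y))\<^sup>2))
        = (1 / sqrt (l n))\<^sup>2 *\<^sub>R (LINT v|lborel. indicator (box a b) (w + (1 / sqrt (l n)) *\<^sub>R v) * exp (- l n * (cmod (w - (w + (1 / sqrt (l n)) *\<^sub>R v)))\<^sup>2))"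
        by (rule integral_lborel_affine_complex) (use lpos[of n] in auto)
      also have "\<dots> = (1 / l n) * k n w"
        using lpos[of n] by (simp add: k_def power_divide power_mult_distrib)
      finally show ?thesis by (simp add: mult_ac)
    qed
    ultimately have "complex_of_real (1 / l n) * (LINT w|lborel. g w * complex_of_real (k n w)) = 0"
      by (simp only: integral_mult_right_zero)
    then show ?thesis using lpos[of n] by simp
  qed
  moreover have "(\<lambda>n. LINT w|lborel. g w * complex_of_real (k n w))
     \<longlonglongrightarrow> (LINT w|lborel. g w * complex_of_real (indicator (box a b) w * m))"
  proof (rule integral_dominated_convergence[where w = "\<lambda>w. norm (g w) * m"])
    show "integrable lborel (\<lambda>w. norm (g w) * m)" using g by simp
    show "AE w in lborel. norm (g w * complex_of_real (k n w)) \<le> norm (g w) * m" for n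
      using k_le by (auto simp: norm_mult intro!: mult_left_mono)
    \<comment> \<open>The boundary of a box is a null set, so the pointwise limit holds almost
      everywhere.\<close>
    show "AE w in lborel. (\<lambda>n. g w * complex_of_real (k n w)) \<longlonglongrightarrow> g w * complex_of_real (indicator (box a b) w * m)"
      using AE_not_in[OF null_sets_cbox_Diff_box[of a b]]
    proof eventually_elim
      case (elim w)
      then show ?case
        using gauss_smoothed_box_limit[OF l lpos elim] unfolding k_def m_def
        by (intro tendsto_mult tendsto_const tendsto_of_real)
    qed
  qed auto
  ultimately have "(LINT w|lborel. g w * complex_of_real (indicator (box a b) w * m)) = 0"
    by (simp add: LIMSEQ_const_iff)
  then have "complex_of_real m * (LINT w|lborel. complex_of_real (indicator (box a b) w) * g w) = 0"
    by (simp only: integral_mult_right_zero[symmetric] of_real_mult mult_ac)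
  then show "(LINT w|lborel. complex_of_real (indicator (box a b) w) * g w) = 0"
    using mpos by simp
qed

context L2_borel
begin

theorem AE_zero_if_gauss_moment_zero:
  assumes zero: "\<And>p q. gauss_moment f (1 / 4) p q = 0"
  shows "AE w in lborel. f w = 0"
proof -
  have "AE w in lborel. f w * complex_of_real (exp (- (cmod w)\<^sup>2 / 4)) = 0"
  \<comment> \<open>The rate 1/4 is already spent on the weight that makes the function integrable,
    so it is subtracted. Starting at \<open>Suc n\<close> keeps the remaining rate positive.\<close>
  proof (rule AE_zero_if_gauss_zero[where l = "\<lambda>n. (3 / 2) ^ Suc n / 4 - 1 / 4"])
    show "integrable lborel (\<lambda>w. f w * complex_of_real (exp (- (cmod w)\<^sup>2 / 4)))"
      using integrable_gauss[of "\<lambda>_. 1" "1/4" 1 0] by simp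
    show "filterlim (\<lambda>n. (3 / 2 :: real) ^ Suc n / 4 - 1 / 4) at_top sequentially"
      by real_asymp
    show pos: "0 < (3 / 2 :: real) ^ Suc n / 4 - 1 / 4" for n
      using one_less_power[of "3 / 2 :: real" "Suc n"] by simp
    show "(LINT w|lborel. f w * complex_of_real (exp (- (cmod w)\<^sup>2 / 4)) *
      complex_of_real (exp (- ((3 / 2) ^ Suc n / 4 - 1 / 4) * (cmod (w - y))\<^sup>2))) = 0" for n y
    proof (rule integral_shifted_gauss)
      show "gauss_moment f (1 / 4 + ((3 / 2) ^ Suc n / 4 - 1 / 4)) p q = 0" for p q
        using gauss_moment_all[OF zero, of "Suc n" p q] by simp
    qed (rule pos)
  qed
  then show ?thesis by simp
qed

end

subsection \<open>Laguerre expansions\<close>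

text \<open>Once all lower coefficients vanish, division by t^n and the limit t to 0 give the n-th
  one. Real and imaginary parts are real power series, since the series is only known at real
  points.\<close>

lemma powser_zero_on_reals:
  fixes d :: "nat \<Rightarrow> complex"
  assumes "\<And>t::real. (\<lambda>n. complex_of_real t ^ n * d n) sums 0"
  shows "d n = 0"
proof -
  have real: "e n = 0" if e: "\<And>t::real. (\<lambda>n. e n * t ^ n) sums 0" for e :: "nat \<Rightarrow> real" and n
  proof (induction n rule: less_induct)
    case (less n)
    have "(\<lambda>i. e (i + n) * t ^ i) sums 0" if "t \<noteq> 0" for t :: real
    proof -
      have "(\<lambda>i. e (i + n) * t ^ (i + n)) sums 0"
        using e[of t] less by (subst sums_zero_iff_shift) auto
      then have "(\<lambda>i. inverse (t ^ n) * (e (i + n) * t ^ (i + n))) sums (inverse (t ^ n) * 0)"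
        by (rule sums_mult)
      then show ?thesis using that by (simp add: power_add field_simps)
    qed
    then have "((\<lambda>_. 0) \<longlongrightarrow> e (0 + n)) (at (0::real))"
      by (intro powser_limit_0_strong[of 1 "\<lambda>i. e (i + n)"]) auto
    then show ?case by (simp add: tendsto_const_iff)
  qed
  have "Re (d n) = 0"
  proof (rule real)
    show "(\<lambda>n. Re (d n) * t ^ n) sums 0" for t
      using sums_Re[OF assms[of t]] by (simp add: of_real_power[symmetric] mult.commute del: of_real_power)
  qed
  moreover have "Im (d n) = 0"
  proof (rule real)
    show "(\<lambda>n. Im (d n) * t ^ n) sums 0" for t
      using sums_Im[OF assms[of t]] by (simp add: of_real_power[symmetric] mult.commute del: of_real_power)
  qed
  ultimately show ?thesis by (simp add: complex_eq_iff)
qed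

text \<open>A nonzero polynomial has finitely many roots, whereas \<open>cis\<close> is injective on
  the infinite set \<open>{0..pi}\<close> because \<open>cos\<close> is.\<close>

lemma polynomial_zero_on_circle:
  fixes h :: "nat \<Rightarrow> complex"
  assumes "\<And>v. cmod v = 1 \<Longrightarrow> (\<Sum>i\<le>n. h i * v ^ i) = 0" and "i \<le> n"
  shows "h i = 0"
proof (rule ccontr)
  assume "h i \<noteq> 0"
  then have "finite {z. (\<Sum>i\<le>n. h i * z ^ i) = 0}"
    using assms(2) polyfun_finite_roots by blast
  then have "finite (cis ` {0..pi})"
    by (rule finite_subset[rotated]) (use assms in auto)
  moreover have "inj_on cis {0..pi}"
  proof (rule inj_onI)
    fix x y assume xy: "x \<in> {0..pi}" "y \<in> {0..pi}" and "cis x = cis y"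
    then have "cos x = cos y" by (metis cis.sel(1))
    then show "x = y" using xy by (auto intro: cos_inj_pi[of x y])
  qed
  ultimately have "finite {0..pi}" by (rule finite_imageD)
  then show False using infinite_Icc[of 0 pi] by simp
qed

text \<open>The coefficient of x^j in the Laguerre polynomial L_k^0(x / 2); it is zero for j >
  k.\<close>

definition lag_coeff :: "nat \<Rightarrow> nat \<Rightarrow> complex" where
  "lag_coeff k j = (- 1 / 2) ^ j * of_nat (k choose j) / fact j"

lemma laguerre_0_eq:
  "complex_of_real (laguerre k 0 (x / 2)) = (\<Sum>j\<le>k. lag_coeff k j * complex_of_real x ^ j)"
proof -
  have "laguerre k 0 (x / 2) = (\<Sum>j\<le>k. (- 1 / 2) ^ j * real (k choose j) / fact j * x ^ j)"
    unfolding laguerre_def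
    by (intro sum.cong) (auto simp: binomial_gbinomial[symmetric] binomial_symmetric[symmetric] power_divide power_minus')
  then show ?thesis
    by (simp add: lag_coeff_def)
qed

text \<open>Laguerre's differential equation in terms of coefficients. It reduces to the absorption
  identity for binomial coefficients; for j > k both sides vanish.\<close>

lemma lag_coeff_rec:
  "2 * of_nat ((j + 1)\<^sup>2) * lag_coeff k (Suc j) = - (of_nat k - of_nat j) * lag_coeff k j"
proof (cases "j \<le> k")
  case True
  have "(of_nat (Suc j * (k choose Suc j)) :: complex) = of_nat ((k - j) * (k choose j))"
    by (metis binomial_absorb_comp binomial_absorption diff_Suc_1 mult.commute)
  then have A: "of_nat (Suc j) * of_nat (k choose Suc j) = (of_nat k - of_nat j) * (of_nat (k choose j) :: complex)"
    using True by (simp add: of_nat_diff del: of_nat_Suc mult_Suc)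
  have B: "2 * of_nat ((j + 1)\<^sup>2) * lag_coeff k (Suc j)
      = - ((- 1 / 2) ^ j * (of_nat (Suc j) * of_nat (k choose Suc j)) / fact j)"
  proof -
    have "(of_nat ((j + 1)\<^sup>2) :: complex) = of_nat (Suc j) * of_nat (Suc j)"
      by (simp only: Suc_eq_plus1 power2_eq_square of_nat_mult)
    then show ?thesis
      by (simp add: lag_coeff_def divide_simps del: of_nat_Suc)
  qed
  show ?thesis
    unfolding B A unfolding lag_coeff_def by (simp add: field_simps)
next
  case False
  then show ?thesis by (simp add: lag_coeff_def binomial_eq_0)
qed

text \<open>
  As a power series in \<open>s = cnj z\<close>, \<open>lag_fps k a w\<close> is the coefficient of \<open>z ^ a\<close> in
  \<open>L_k ((z - w) (s - cnj w) / 2) exp (s w / 2)\<close>, which is the kernel of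
  \<open>f \<mapsto> exp (|z|^2 / 4) (f \<times> \<phi>_k) z\<close> up to the weight \<open>exp (- |w|^2 / 4)\<close>.
\<close>

definition lag_fps :: "nat \<Rightarrow> nat \<Rightarrow> complex \<Rightarrow> complex fps" where
  "lag_fps k a w = (\<Sum>j\<le>k. fps_const (lag_coeff k j * of_nat (j choose a) * (- w) ^ (j - a)) *
     ((fps_X - fps_const (cnj w)) ^ j * fps_exp (w / 2)))"

text \<open>
  Coefficientwise form of the eigenvalue equation of the twisted Laplacian, which for
  \<open>u = exp(|z|^2/4) (f \<times> \<phi>_k)\<close> reads \<open>2 \<partial>_z \<partial>_cnj(z) u = z \<partial>_z u - k u\<close>.
\<close>

lemma lag_fps_deriv:
  "fps_const (2 * of_nat (Suc a)) * fps_deriv (lag_fps k (Suc a) w)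
     = fps_const (of_nat a - of_nat k) * lag_fps k a w"
proof -
  define y where "y = fps_X - fps_const (cnj w)"
  define E where "E = fps_exp (w / 2)"
  define C where "C j = lag_coeff k j * of_nat (j choose Suc a) * (- w) ^ (j - Suc a)" for j
  have dy: "fps_deriv y = 1" by (simp add: y_def)
  have dE: "fps_deriv E = fps_const (w / 2) * E" by (simp add: E_def)
  have dterm: "fps_deriv (fps_const (C j) * (y ^ j * E))
      = fps_const (of_nat j * C j) * (y ^ (j - 1) * E) + fps_const (w / 2 * C j) * (y ^ j * E)" for j
    by (simp add: fps_deriv_power dy dE algebra_simps fps_const_mult[symmetric] del: fps_const_mult)
  have "fps_deriv (lag_fps k (Suc a) w) = (\<Sum>j\<le>k. fps_deriv (fps_const (C j) * (y ^ j * E)))"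
    unfolding lag_fps_def fps_deriv_sum C_def y_def E_def ..
  also have "\<dots> = (\<Sum>j\<le>k. fps_const (of_nat j * C j) * (y ^ (j - 1) * E))
      + (\<Sum>j\<le>k. fps_const (w / 2 * C j) * (y ^ j * E))"
    unfolding dterm by (rule sum.distrib)
  \<comment> \<open>The added term is zero because \<open>lag_coeff k (Suc k)\<close> is, and after
    the index shift the range is again j \<le> k.\<close>
  also have "(\<Sum>j\<le>k. fps_const (of_nat j * C j) * (y ^ (j - 1) * E))
      = (\<Sum>j\<le>Suc k. fps_const (of_nat j * C j) * (y ^ (j - 1) * E))"
    by (simp add: C_def lag_coeff_def)
  also have "\<dots> = (\<Sum>j\<le>k. fps_const (of_nat (Suc j) * C (Suc j)) * (y ^ j * E))"
    by (subst sum.atMost_Suc_shift) simp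
  finally have D: "fps_deriv (lag_fps k (Suc a) w)
      = (\<Sum>j\<le>k. fps_const (of_nat (Suc j) * C (Suc j)) * (y ^ j * E) + fps_const (w / 2 * C j) * (y ^ j * E))"
    by (simp only: sum.distrib)
  have add: "fps_const P * Z + fps_const Q * Z = fps_const (P + Q) * Z" for P Q and Z :: "complex fps"
    by (simp only: distrib_right fps_const_add[symmetric])
  have mult: "fps_const P * (fps_const Q * Z) = fps_const (P * Q) * Z" for P Q and Z :: "complex fps"
    by (simp only: fps_const_mult[symmetric] mult.assoc)
  have "fps_const (2 * of_nat (Suc a)) * fps_deriv (lag_fps k (Suc a) w)
      = (\<Sum>j\<le>k. fps_const (2 * of_nat (Suc a) * (of_nat (Suc j) * C (Suc j) + w / 2 * C j)) * (y ^ j * E))"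
    by (simp only: D sum_distrib_left add mult)
  also have "\<dots> = (\<Sum>j\<le>k. fps_const ((of_nat a - of_nat k) * (lag_coeff k j * of_nat (j choose a) * (- w) ^ (j - a))) * (y ^ j * E))"
  proof (rule sum.cong)
    fix j
    have abs1: "of_nat (Suc a) * of_nat (Suc j choose Suc a) = (of_nat (Suc j) * of_nat (j choose a) :: complex)"
      by (metis Suc_times_binomial_eq mult.commute of_nat_mult)
    \<comment> \<open>The factor \<open>w\<close> produced by differentiating the exponential
      restores the missing power of \<open>- w\<close>, with a sign. For j \<le> a both sides are
      zero.\<close>
    have abs2: "of_nat (Suc a) * of_nat (j choose Suc a) * (w * (- w) ^ (j - Suc a))
        = - (of_nat j - of_nat a) * of_nat (j choose a) * ((- w) ^ (j - a) :: complex)"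
    proof (cases "Suc a \<le> j")
      case True
      have "Suc a * (j choose Suc a) = (j - a) * (j choose a)"
        by (metis binomial_absorb_comp binomial_absorption diff_Suc_1 mult.commute)
      then have "of_nat (Suc a) * of_nat (j choose Suc a) = (of_nat j - of_nat a) * (of_nat (j choose a) :: complex)"
        using True by (metis Suc_leD of_nat_diff of_nat_mult)
      moreover have "(- w) ^ (j - a) = - (w * (- w) ^ (j - Suc a))"
        using True by (metis Suc_diff_le diff_Suc_Suc mult_minus_left power_Suc)
      ultimately show ?thesis
        by (simp only: mult_minus_left mult_minus_right minus_minus)
    next
      case False
      then show ?thesis by (cases "j = a") (auto simp: binomial_eq_0)
    qed
    have "2 * of_nat (Suc a) * (of_nat (Suc j) * C (Suc j) + w / 2 * C j)
      = 2 * of_nat (Suc j) * lag_coeff k (Suc j) * (of_nat (Suc a) * of_nat (Suc j choose Suc a)) * (- w) ^ (j - a)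
        + lag_coeff k j * (of_nat (Suc a) * of_nat (j choose Suc a) * (w * (- w) ^ (j - Suc a)))"
      unfolding C_def by (simp only: diff_Suc_Suc) (simp add: algebra_simps)
    also have "\<dots> = (2 * of_nat ((j + 1)\<^sup>2) * lag_coeff k (Suc j)) * of_nat (j choose a) * (- w) ^ (j - a)
        - lag_coeff k j * ((of_nat j - of_nat a) * of_nat (j choose a) * (- w) ^ (j - a))"
      unfolding abs1 abs2 by (simp add: power2_eq_square algebra_simps)
    \<comment> \<open>By the Laguerre recurrence the first summand carries the factor j - k, the
      second a - j; their sum is free of \<open>j\<close>, so it can be taken out of the whole
      sum.\<close>
    also have "\<dots> = (of_nat a - of_nat k) * (lag_coeff k j * of_nat (j choose a) * (- w) ^ (j - a))"
      unfolding lag_coeff_rec by (simp add: algebra_simps)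
    finally show "fps_const (2 * of_nat (Suc a) * (of_nat (Suc j) * C (Suc j) + w / 2 * C j)) * (y ^ j * E)
      = fps_const ((of_nat a - of_nat k) * (lag_coeff k j * of_nat (j choose a) * (- w) ^ (j - a))) * (y ^ j * E)"
      by simp
  qed simp
  also have "\<dots> = fps_const (of_nat a - of_nat k) * lag_fps k a w"
    by (simp add: lag_fps_def y_def E_def sum_distrib_left mult.assoc fps_const_mult[symmetric] del: fps_const_mult)
  finally show ?thesis .
qed

text \<open>The coefficient of s^b in s^i exp (s w / 2).\<close>

definition shifted_exp_coeff :: "nat \<Rightarrow> nat \<Rightarrow> complex \<Rightarrow> complex" where
  "shifted_exp_coeff i b w = (if b < i then 0 else (w / 2) ^ (b - i) / fact (b - i))"

lemma lag_fps_nth: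
  "fps_nth (lag_fps k a w) b = (\<Sum>j\<le>k. lag_coeff k j * of_nat (j choose a) * (- w) ^ (j - a) *
     (\<Sum>i\<le>j. of_nat (j choose i) * (- cnj w) ^ (j - i) * shifted_exp_coeff i b w))"
proof -
  have "fps_nth ((fps_X - fps_const (cnj w)) ^ j * fps_exp (w / 2)) b
     = (\<Sum>i\<le>j. of_nat (j choose i) * (- cnj w) ^ (j - i) * shifted_exp_coeff i b w)" for j
  proof -
    have pow: "(- fps_const (cnj w)) ^ m = fps_const ((- cnj w) ^ m)" for m
      by simp
    have "(fps_X - fps_const (cnj w)) ^ j * fps_exp (w / 2)
      = (\<Sum>i\<le>j. fps_const (of_nat (j choose i) * (- cnj w) ^ (j - i)) * (fps_X ^ i * fps_exp (w / 2)))"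
      unfolding diff_conv_add_uminus binomial_ring sum_distrib_right
      by (intro sum.cong refl) (simp only: pow fps_of_nat[symmetric] fps_const_mult[symmetric] mult_ac)
    then show ?thesis
      by (simp add: fps_sum_nth fps_X_power_mult_nth shifted_exp_coeff_def fps_exp_def cong: if_cong)
  qed
  then show ?thesis
    by (simp add: lag_fps_def fps_sum_nth)
qed

lemma lag_fps_nth_rec:
  "2 * of_nat (Suc a) * of_nat (Suc b) * fps_nth (lag_fps k (Suc a) w) (Suc b)
     = (of_nat a - of_nat k) * fps_nth (lag_fps k a w) b"
  using arg_cong[OF lag_fps_deriv[of a k w], of "\<lambda>F. fps_nth F b"]
  by (simp add: fps_deriv_nth mult_ac)

text \<open>Only j = k survives, since \<open>j choose k\<close> is zero for j < k.\<close>

lemma lag_fps_nth_top: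
  "fps_nth (lag_fps k k w) b = lag_coeff k k *
     (\<Sum>i\<le>k. of_nat (k choose i) * (- cnj w) ^ (k - i) * shifted_exp_coeff i b w)"
proof -
  have "fps_nth (lag_fps k k w) b = (\<Sum>j\<le>k. if j = k then lag_coeff k k *
     (\<Sum>i\<le>k. of_nat (k choose i) * (- cnj w) ^ (k - i) * shifted_exp_coeff i b w) else 0)"
    unfolding lag_fps_nth by (intro sum.cong) auto
  then show ?thesis by simp
qed

text \<open>
  The coefficients on a diagonal \<open>b - a = const\<close> are determined by the one with \<open>a = k\<close>, so the
  topmost nonzero coefficient of the restriction to the real line is a single \<open>c k b\<close>.
\<close>

lemma diagonal_coefficients_vanish:
  fixes c :: "nat \<Rightarrow> nat \<Rightarrow> complex"
  assumes rec: "\<And>a b. 2 * of_nat (Suc a) * of_nat (Suc b) * c (Suc a) (Suc b) = (of_nat a - of_nat k) * c a b"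
    and fin: "\<And>n a. n > M \<Longrightarrow> a \<le> k \<Longrightarrow> a \<le> n \<Longrightarrow> c a (n - a) = 0"
    and zero: "\<And>n. (\<Sum>a\<le>k. if n < a then 0 else c a (n - a)) = 0"
  shows "c k b = 0"
proof -
  \<comment> \<open>The recurrence is followed down a diagonal. Its right-hand factor (k - Suc m) -
    k is nonzero, so a zero at one place forces a zero at the previous one.\<close>
  have diag: "c k (b + m) = 0 \<Longrightarrow> m \<le> k \<Longrightarrow> c (k - m) b = 0" for b m
  proof (induction m arbitrary: b)
    case (Suc m)
    have "c (k - m) (Suc b) = 0" using Suc by simp
    then have "(of_nat (k - Suc m) - of_nat k) * c (k - Suc m) b = 0"
      using rec[of "k - Suc m" b] Suc.prems by (simp add: Suc_diff_Suc)
    moreover have "(of_nat (k - Suc m) :: complex) \<noteq> of_nat k"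
      using Suc.prems by (simp only: of_nat_eq_iff)
    ultimately show ?case by simp
  qed simp
  show ?thesis
  \<comment> \<open>Descending induction on \<open>b\<close>; beyond \<open>M\<close> the assumption
    \<open>fin\<close> with a = k applies.\<close>
  proof (induction "M - b" arbitrary: b rule: less_induct)
    case less
    have larger: "c k b' = 0" if "b' > b" for b'
    proof (cases "b' \<le> M")
      case True
      then show ?thesis using that by (intro less) auto
    next
      case False
      then show ?thesis using fin[of "k + b'" k] by simp
    qed
    \<comment> \<open>An entry with a = k - m and m > 0 lies on the diagonal that ends in
      \<open>c k (b + 2 * m)\<close>, which already vanishes.\<close>
    have "(\<Sum>a\<le>k. if k + b < a then 0 else c a (k + b - a)) = (\<Sum>a\<le>k. if a = k then c k b else 0)"
    proof (rule sum.cong)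
      fix a assume a: "a \<in> {..k}"
      show "(if k + b < a then 0 else c a (k + b - a)) = (if a = k then c k b else 0)"
      proof (cases "a = k")
        case False
        define m where "m = k - a"
        have "c (k - m) (b + m) = 0"
          using a False by (intro diag larger) (auto simp: m_def)
        then show ?thesis using a False by (simp add: m_def add.commute)
      qed simp
    qed simp
    then show ?case using zero[of "k + b"] by simp
  qed
qed

section \<open>Functions of at most exponential growth, as test functions against the Gaussian
  weight\<close>

definition exp_bounded :: "(complex \<Rightarrow> complex) \<Rightarrow> bool" where
  "exp_bounded h \<longleftrightarrow> h \<in> borel_measurable borel \<and>
     (\<exists>B C. B \<ge> 0 \<and> C \<ge> 0 \<and> (\<forall>w. cmod (h w) \<le> B * exp (C * cmod w)))"

named_theorems exp_bounded_intros

lemma exp_boundedI: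
  assumes "h \<in> borel_measurable borel" "B \<ge> 0" "C \<ge> 0" "\<And>w. cmod (h w) \<le> B * exp (C * cmod w)"
  shows "exp_bounded h"
  using assms unfolding exp_bounded_def by blast

lemma exp_bounded_const [exp_bounded_intros]: "exp_bounded (\<lambda>w. c)"
  by (rule exp_boundedI[of _ "cmod c" 0]) auto

lemma exp_bounded_ident [exp_bounded_intros]: "exp_bounded (\<lambda>w. w)"
  using power_le_fact_exp[of "cmod _" 1] by (intro exp_boundedI[of _ 1 1]) auto

lemma exp_bounded_cnj [exp_bounded_intros]: "exp_bounded cnj"
  using power_le_fact_exp[of "cmod _" 1] by (intro exp_boundedI[of _ 1 1]) auto

lemma exp_bounded_add [exp_bounded_intros]:
  assumes "exp_bounded g" "exp_bounded h"
  shows "exp_bounded (\<lambda>w. g w + h w)"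
proof -
  obtain B C B' C' where *: "B \<ge> 0" "C \<ge> 0" "B' \<ge> 0" "C' \<ge> 0"
      "\<And>w. cmod (g w) \<le> B * exp (C * cmod w)" "\<And>w. cmod (h w) \<le> B' * exp (C' * cmod w)"
    using assms by (auto simp: exp_bounded_def)
  show ?thesis
  proof (rule exp_boundedI[of _ "B + B'" "C + C'"])
    fix w
    have "cmod (g w) \<le> B * exp ((C + C') * cmod w)"
      using * by (intro order.trans[OF *(5)] mult_left_mono) (auto simp: algebra_simps)
    moreover have "cmod (h w) \<le> B' * exp ((C + C') * cmod w)"
      using * by (intro order.trans[OF *(6)] mult_left_mono) (auto simp: algebra_simps)
    ultimately show "cmod (g w + h w) \<le> (B + B') * exp ((C + C') * cmod w)"
      using norm_triangle_ineq[of "g w" "h w"] by (simp add: distrib_right)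
  qed (use assms * in \<open>auto simp: exp_bounded_def\<close>)
qed

lemma exp_bounded_mult [exp_bounded_intros]:
  assumes "exp_bounded g" "exp_bounded h"
  shows "exp_bounded (\<lambda>w. g w * h w)"
proof -
  obtain B C B' C' where *: "B \<ge> 0" "C \<ge> 0" "B' \<ge> 0" "C' \<ge> 0"
      "\<And>w. cmod (g w) \<le> B * exp (C * cmod w)" "\<And>w. cmod (h w) \<le> B' * exp (C' * cmod w)"
    using assms by (auto simp: exp_bounded_def)
  show ?thesis
  proof (rule exp_boundedI[of _ "B * B'" "C + C'"])
    fix w
    have "cmod (g w) * cmod (h w) \<le> (B * exp (C * cmod w)) * (B' * exp (C' * cmod w))"
      using * by (intro mult_mono) auto
    then show "cmod (g w * h w) \<le> (B * B') * exp ((C + C') * cmod w)"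
      unfolding distrib_right exp_add norm_mult by (simp only: mult_ac)
  qed (use assms * in \<open>auto simp: exp_bounded_def\<close>)
qed

lemma exp_bounded_minus [exp_bounded_intros]: "exp_bounded g \<Longrightarrow> exp_bounded (\<lambda>w. - g w)"
  using exp_bounded_mult[OF exp_bounded_const[of "-1"]] by simp

lemma exp_bounded_diff [exp_bounded_intros]:
  "exp_bounded g \<Longrightarrow> exp_bounded h \<Longrightarrow> exp_bounded (\<lambda>w. g w - h w)"
  using exp_bounded_add[OF _ exp_bounded_minus] by simp

lemma exp_bounded_power [exp_bounded_intros]: "exp_bounded g \<Longrightarrow> exp_bounded (\<lambda>w. g w ^ n)"
  by (induction n) (auto intro: exp_bounded_intros)

lemma exp_bounded_sum [exp_bounded_intros]:
  "(\<And>i. i \<in> I \<Longrightarrow> exp_bounded (g i)) \<Longrightarrow> exp_bounded (\<lambda>w. \<Sum>i\<in>I. g i w)"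
  by (induction I rule: infinite_finite_induct) (auto intro: exp_bounded_intros)

lemma exp_bounded_exp_linear [exp_bounded_intros]: "exp_bounded (\<lambda>w. exp (s * w / 2))"
proof (rule exp_boundedI[of _ 1 "cmod s"])
  fix w
  have "Re (s * w / 2) \<le> cmod (s * w / 2)" by (rule complex_Re_le_cmod)
  also have "\<dots> \<le> cmod s * cmod w" by (simp add: norm_mult)
  finally show "cmod (exp (s * w / 2)) \<le> 1 * exp (cmod s * cmod w)"
    by (simp only: norm_exp_eq_Re mult_1 exp_le_cancel_iff)
qed auto

lemma exp_bounded_exp_cmod [exp_bounded_intros]: "exp_bounded (\<lambda>w. complex_of_real (exp (cmod (s * w / 2))))"
  by (rule exp_boundedI[of _ 1 "cmod s"]) (auto simp: norm_mult)

lemma exp_bounded_shifted_exp_coeff [exp_bounded_intros]: "exp_bounded (shifted_exp_coeff i b)"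
proof (cases "b < i")
  case True
  then show ?thesis by (simp add: shifted_exp_coeff_def[abs_def] exp_bounded_const)
next
  case False
  have "exp_bounded (\<lambda>w. (w * (1 / 2)) ^ (b - i) * (1 / fact (b - i)))"
    by (intro exp_bounded_intros)
  then show ?thesis using False by (simp add: shifted_exp_coeff_def[abs_def])
qed

text \<open>The value of the power series \<open>lag_fps k a w\<close> at \<open>s\<close>.\<close>

definition lag_slice :: "nat \<Rightarrow> nat \<Rightarrow> complex \<Rightarrow> complex \<Rightarrow> complex" where
  "lag_slice k a s w = (\<Sum>j\<le>k. lag_coeff k j * of_nat (j choose a) * (- w) ^ (j - a) *
     ((s - cnj w) ^ j * exp (s * w / 2)))"

lemma exp_bounded_lag_slice [exp_bounded_intros]: "exp_bounded (lag_slice k a s)"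
  unfolding lag_slice_def by (intro exp_bounded_intros)

section \<open>Expansion coefficients as Gaussian pairings\<close>

context L2_borel
begin

definition pairing :: "(complex \<Rightarrow> complex) \<Rightarrow> complex" where
  "pairing h = (LINT w|lborel. f w * (complex_of_real (exp (- (1 / 4) * (cmod w)\<^sup>2)) * h w))"

lemma integrable_pairing:
  assumes "exp_bounded h"
  shows "integrable lborel (\<lambda>w. f w * (complex_of_real (exp (- (1 / 4) * (cmod w)\<^sup>2)) * h w))"
proof -
  obtain B C where "h \<in> borel_measurable borel" "\<And>w. cmod (h w) \<le> B * exp (C * cmod w)"
    using assms by (auto simp: exp_bounded_def)
  then show ?thesis by (intro integrable_gauss) auto
qed

lemma pairing_mult: "pairing (\<lambda>w. c * h w) = c * pairing h"
  unfolding pairing_def integral_mult_right_zero[symmetric]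
  by (rule Bochner_Integration.integral_cong) auto

lemma pairing_sum:
  assumes "\<And>i. i \<in> I \<Longrightarrow> exp_bounded (h i)"
  shows "pairing (\<lambda>w. \<Sum>i\<in>I. h i w) = (\<Sum>i\<in>I. pairing (h i))"
proof -
  have "pairing (\<lambda>w. \<Sum>i\<in>I. h i w)
      = (LINT w|lborel. (\<Sum>i\<in>I. f w * (complex_of_real (exp (- (1 / 4) * (cmod w)\<^sup>2)) * h i w)))"
    unfolding pairing_def by (simp add: sum_distrib_left)
  also have "\<dots> = (\<Sum>i\<in>I. pairing (h i))"
    unfolding pairing_def using assms
    by (intro Bochner_Integration.integral_sum integrable_pairing)
  finally show ?thesis .
qed

lemma gauss_moment_eq_pairing: "gauss_moment f (1 / 4) p q = pairing (\<lambda>w. w ^ p * cnj w ^ q)"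
  by (simp add: gauss_moment_def pairing_def mult.assoc)

text \<open>The exponential series is integrated term by term; the factor s^i shifts the index by
  \<open>i\<close>.\<close>

lemma pairing_exp_sums:
  assumes g: "exp_bounded g"
  shows "(\<lambda>b. pairing (\<lambda>w. g w * shifted_exp_coeff i b w) * s ^ b)
     sums pairing (\<lambda>w. g w * (s ^ i * exp (s * w / 2)))"
proof -
  define H where "H w = f w * (complex_of_real (exp (- (1 / 4) * (cmod w)\<^sup>2)) * g w)" for w
  have [measurable]: "g \<in> borel_measurable borel" using g by (simp add: exp_bounded_def)
  have [measurable]: "H \<in> borel_measurable borel" unfolding H_def by measurable
  have "integrable lborel (\<lambda>w. f w * (complex_of_real (exp (- (1 / 4) * (cmod w)\<^sup>2)) * (g w * complex_of_real (exp (cmod (s * w / 2))))))"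
    by (intro integrable_pairing exp_bounded_intros g)
  then have "integrable lborel (\<lambda>w. H w * complex_of_real (exp (cmod (s * w / 2))))"
    by (simp add: H_def mult_ac)
  then have "(\<lambda>n. LINT w|lborel. H w * ((s * w / 2) ^ n / fact n)) sums (LINT w|lborel. H w * exp (s * w / 2))"
    by (intro integral_exp_series) auto
  then have "(\<lambda>n. s ^ i * (LINT w|lborel. H w * ((s * w / 2) ^ n / fact n))) sums (s ^ i * (LINT w|lborel. H w * exp (s * w / 2)))"
    by (rule sums_mult)
  also have "s ^ i * (LINT w|lborel. H w * exp (s * w / 2)) = pairing (\<lambda>w. g w * (s ^ i * exp (s * w / 2)))"
    unfolding pairing_def integral_mult_right_zero[symmetric]
    by (rule Bochner_Integration.integral_cong) (auto simp: H_def)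
  also have "(\<lambda>n. s ^ i * (LINT w|lborel. H w * ((s * w / 2) ^ n / fact n)))
      = (\<lambda>n. pairing (\<lambda>w. g w * shifted_exp_coeff i (n + i) w) * s ^ (n + i))"
  proof
    fix n
    have "pairing (\<lambda>w. g w * shifted_exp_coeff i (n + i) w) * s ^ (n + i)
       = (LINT w|lborel. s ^ (n + i) * (f w * (complex_of_real (exp (- (1 / 4) * (cmod w)\<^sup>2)) * (g w * shifted_exp_coeff i (n + i) w))))"
      by (simp add: pairing_def)
    also have "\<dots> = (LINT w|lborel. s ^ i * (H w * ((s * w / 2) ^ n / fact n)))"
      by (rule Bochner_Integration.integral_cong)
        (simp_all add: H_def shifted_exp_coeff_def power_add power_mult_distrib power_divide)
    finally show "s ^ i * (LINT w|lborel. H w * ((s * w / 2) ^ n / fact n))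
      = pairing (\<lambda>w. g w * shifted_exp_coeff i (n + i) w) * s ^ (n + i)"
      by simp
  qed
  \<comment> \<open>The coefficients with index below \<open>i\<close> are zero, so the summation
    may start at 0.\<close>
  finally show ?thesis
    by (subst (asm) sums_zero_iff_shift) (simp_all add: shifted_exp_coeff_def pairing_def)
qed

text \<open>The coefficient of z^a cnj(z)^b in the expansion of exp (|z|^2 / 4) (f \<times>
  \<phi>_k) z.\<close>

definition lag_pairing :: "nat \<Rightarrow> nat \<Rightarrow> nat \<Rightarrow> complex" where
  "lag_pairing k a b = pairing (\<lambda>w. fps_nth (lag_fps k a w) b)"

text \<open>Expanding (s - cnj w)^j by the binomial theorem leaves a finite sum of terms s^i exp (s
  w / 2) with exponentially bounded coefficients, each of which can be expanded under the
  integral.\<close>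

lemma lag_pairing_sums: "(\<lambda>b. lag_pairing k a b * s ^ b) sums pairing (lag_slice k a s)"
proof -
  define g where "g j i w = lag_coeff k j * of_nat (j choose a) * (- w) ^ (j - a) * (of_nat (j choose i) * (- cnj w) ^ (j - i))"
    for j i w
  have g: "exp_bounded (g j i)" for j i
    unfolding g_def by (intro exp_bounded_intros)
  have "(\<lambda>b. \<Sum>j\<le>k. \<Sum>i\<le>j. pairing (\<lambda>w. g j i w * shifted_exp_coeff i b w) * s ^ b)
     sums (\<Sum>j\<le>k. \<Sum>i\<le>j. pairing (\<lambda>w. g j i w * (s ^ i * exp (s * w / 2))))"
    by (intro sums_sum pairing_exp_sums g)
  also have "(\<lambda>b. \<Sum>j\<le>k. \<Sum>i\<le>j. pairing (\<lambda>w. g j i w * shifted_exp_coeff i b w) * s ^ b)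
     = (\<lambda>b. lag_pairing k a b * s ^ b)"
  proof
    fix b
    have "(\<Sum>j\<le>k. \<Sum>i\<le>j. pairing (\<lambda>w. g j i w * shifted_exp_coeff i b w))
       = pairing (\<lambda>w. \<Sum>j\<le>k. \<Sum>i\<le>j. g j i w * shifted_exp_coeff i b w)"
      by (subst pairing_sum, intro exp_bounded_intros g)+ simp
    also have "\<dots> = lag_pairing k a b"
      by (simp add: lag_pairing_def lag_fps_nth g_def sum_distrib_left mult.assoc)
    finally show "(\<Sum>j\<le>k. \<Sum>i\<le>j. pairing (\<lambda>w. g j i w * shifted_exp_coeff i b w) * s ^ b) = lag_pairing k a b * s ^ b"
      by (simp add: sum_distrib_right[symmetric])
  qed
  also have "(\<Sum>j\<le>k. \<Sum>i\<le>j. pairing (\<lambda>w. g j i w * (s ^ i * exp (s * w / 2))))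
     = pairing (\<lambda>w. \<Sum>j\<le>k. \<Sum>i\<le>j. g j i w * (s ^ i * exp (s * w / 2)))"
    by (subst pairing_sum, intro exp_bounded_intros g)+ simp
  also have "(\<lambda>w. \<Sum>j\<le>k. \<Sum>i\<le>j. g j i w * (s ^ i * exp (s * w / 2))) = lag_slice k a s"
  proof
    fix w
    have "(s - cnj w) ^ j = (\<Sum>i\<le>j. of_nat (j choose i) * (- cnj w) ^ (j - i) * s ^ i)" for j
      unfolding diff_conv_add_uminus binomial_ring by (intro sum.cong) auto
    then show "(\<Sum>j\<le>k. \<Sum>i\<le>j. g j i w * (s ^ i * exp (s * w / 2))) = lag_slice k a s w"
      by (simp add: lag_slice_def g_def sum_distrib_left sum_distrib_right mult_ac)
  qed
  finally show ?thesis .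
qed

text \<open>The coefficient \<open>lag_pairing q q p\<close> is a combination of the moments with
  exponents p - i and q - i, and the one with i = 0 has a nonzero factor. This system is triangular
  in \<open>q\<close>, the exponent of \<open>cnj w\<close>.\<close>

lemma gauss_moment_zero_if_lag_pairing_zero:
  assumes zero: "\<And>k b. lag_pairing k k b = 0"
  shows "gauss_moment f (1 / 4) p q = 0"
proof (induction q arbitrary: p rule: less_induct)
  case (less q)
  define T where "T i w = of_nat (q choose i) * (- cnj w) ^ (q - i) * shifted_exp_coeff i p w" for i w
  have T: "exp_bounded (T i)" for i
    unfolding T_def by (intro exp_bounded_intros)
  have T_eq: "pairing (T i) = (if p < i then 0 else
      of_nat (q choose i) * (- 1) ^ (q - i) * (1 / 2) ^ (p - i) / fact (p - i) * gauss_moment f (1 / 4) (p - i) (q - i))" for i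
  proof (cases "p < i")
    case True
    then show ?thesis by (simp add: T_def shifted_exp_coeff_def pairing_def)
  next
    case False
    have "T i = (\<lambda>w. of_nat (q choose i) * (- 1) ^ (q - i) * (1 / 2) ^ (p - i) / fact (p - i) * (w ^ (p - i) * cnj w ^ (q - i)))"
      using False by (auto simp: T_def shifted_exp_coeff_def power_divide power_minus[of "cnj _"])
    then show ?thesis
      using False by (simp only: pairing_mult gauss_moment_eq_pairing if_False)
  qed
  have "0 = lag_pairing q q p" using zero by simp
  also have "\<dots> = pairing (\<lambda>w. lag_coeff q q * (\<Sum>i\<le>q. T i w))"
    by (simp add: lag_pairing_def lag_fps_nth_top T_def)
  also have "\<dots> = lag_coeff q q * (\<Sum>i\<le>q. pairing (T i))"
    by (simp only: pairing_mult pairing_sum[OF T])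
  \<comment> \<open>For i > 0 either p < i, or the moment has a smaller second exponent and vanishes
    by induction.\<close>
  also have "(\<Sum>i\<le>q. pairing (T i)) = (\<Sum>i\<le>q. if i = 0 then pairing (T 0) else 0)"
    using less by (intro sum.cong) (auto simp: T_eq)
  also have "\<dots> = pairing (T 0)" by simp
  finally show ?case by (simp add: T_eq lag_coeff_def)
qed

end

subsection \<open>Twisted convolution with Laguerre functions\<close>

lemma distr_lborel_minus: "distr lborel borel (\<lambda>w. z - w) = (lborel :: complex measure)"
  by (subst lborel_affine[of "-1" z]) (auto simp: density_1 one_ennreal_def[symmetric])

lemma AE_lborel_minus:
  fixes z :: complex
  assumes "AE w in lborel. P w"
  shows "AE w in lborel. P (z - w)"
proof -
  obtain N where N: "N \<in> null_sets lborel" and P: "\<And>w. w \<notin> N \<Longrightarrow> P w"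
    using assms by (elim AE_E) (force simp: null_sets_def)
  have [measurable]: "N \<in> sets borel" using N by auto
  have "emeasure (distr lborel borel (\<lambda>w. z - w)) N = 0"
    unfolding distr_lborel_minus using N by auto
  then have "(\<lambda>w. z - w) -` N \<in> null_sets lborel"
    using measurable_sets[of "\<lambda>w. z - w" borel borel N] by (auto simp: emeasure_distr null_sets_def)
  then show ?thesis
    by (rule AE_mp[OF AE_not_in]) (auto intro: P)
qed

lemma lebesgue_measurable_ex_borel:
  fixes f :: "complex \<Rightarrow> complex"
  assumes f: "f \<in> borel_measurable lebesgue"
  obtains g where "g \<in> borel_measurable borel" "AE w in lborel. f w = g w"
proof -
  have "(\<lambda>w. Re (f w)) \<in> borel_measurable lebesgue" "(\<lambda>w. Im (f w)) \<in> borel_measurable lebesgue"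
    using f by measurable
  then obtain u v where [measurable]: "u \<in> borel_measurable lborel" "v \<in> borel_measurable lborel"
    and u: "AE w in lborel. Re (f w) = u w" and v: "AE w in lborel. Im (f w) = v w"
    by (blast dest: completion_ex_borel_measurable_real)
  show thesis
  proof
    show "(\<lambda>w. complex_of_real (u w) + \<i> * complex_of_real (v w)) \<in> borel_measurable borel"
      by measurable
    show "AE w in lborel. f w = complex_of_real (u w) + \<i> * complex_of_real (v w)"
      using u v by eventually_elim (simp add: complex_eq_iff)
  qed
qed

lemma measurable_laguerre_fun [measurable]: "laguerre_fun k \<in> borel \<rightarrow>\<^sub>M borel"
  unfolding laguerre_fun_def laguerre_def by measurable

lemma measurable_twist [measurable]: "twist z \<in> borel \<rightarrow>\<^sub>M borel"
  unfolding twist_def by measurable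

lemma twisted_conv_borel:
  assumes [measurable]: "g \<in> borel_measurable borel" and ae: "AE w in lborel. f w = g w"
  shows "twisted_conv f (laguerre_fun k) z = (LINT w|lborel. g (z - w) * laguerre_fun k w * twist z w)"
  unfolding twisted_conv_def
  by (rule integral_completion_AE) (use AE_lborel_minus[OF ae, of z] in \<open>auto elim!: eventually_mono\<close>)

text \<open>In the total exponent the terms |z|^2 and z cnj(w) cancel, leaving cnj(z) w / 2 - |w|^2
  / 4. So, with cnj(z) as a separate variable, \<open>z\<close> enters only through the powers (z -
  w)^j of the Laguerre polynomial, hence with degree at most \<open>k\<close>.\<close>

lemma twisted_laguerre_kernel:
  "complex_of_real (exp ((cmod z)\<^sup>2 / 4)) * (laguerre_fun k (z - w) * twist z (z - w))
    = complex_of_real (exp (- (1 / 4) * (cmod w)\<^sup>2)) * (\<Sum>a\<le>k. z ^ a * lag_slice k a (cnj z) w)"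
proof -
  have sq: "complex_of_real ((cmod (z - w))\<^sup>2) = (z - w) * (cnj z - cnj w)"
    by (simp only: complex_norm_square) simp
  have Im: "\<i> / 2 * complex_of_real (Im (z * cnj (z - w))) = (z * cnj (z - w) - cnj (z * cnj (z - w))) / 4"
    by (simp add: complex_eq_iff algebra_simps)
  have "complex_of_real ((cmod z)\<^sup>2 / 4) + (- complex_of_real ((cmod (z - w))\<^sup>2) / 4 + \<i> / 2 * complex_of_real (Im (z * cnj (z - w))))
     = complex_of_real (- (1 / 4) * (cmod w)\<^sup>2) + cnj z * w / 2"
    unfolding Im sq of_real_mult of_real_divide complex_norm_square by (simp add: field_simps)
  then have "exp (complex_of_real ((cmod z)\<^sup>2 / 4)) * (exp (- complex_of_real ((cmod (z - w))\<^sup>2) / 4) * exp (\<i> / 2 * complex_of_real (Im (z * cnj (z - w)))))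
     = exp (complex_of_real (- (1 / 4) * (cmod w)\<^sup>2)) * exp (cnj z * w / 2)"
    by (simp only: exp_add[symmetric])
  then have E: "complex_of_real (exp ((cmod z)\<^sup>2 / 4)) * (complex_of_real (exp (- (cmod (z - w))\<^sup>2 / 4)) * twist z (z - w))
     = complex_of_real (exp (- (1 / 4) * (cmod w)\<^sup>2)) * exp (cnj z * w / 2)"
    by (simp add: twist_def exp_of_real[symmetric])
  have "(z - w) ^ j = (\<Sum>a\<le>k. of_nat (j choose a) * z ^ a * (- w) ^ (j - a))" if "j \<le> k" for j
  proof -
    have "(z - w) ^ j = (\<Sum>a\<le>j. of_nat (j choose a) * z ^ a * (- w) ^ (j - a))"
      unfolding diff_conv_add_uminus binomial_ring ..
    also have "\<dots> = (\<Sum>a\<le>k. of_nat (j choose a) * z ^ a * (- w) ^ (j - a))"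
      using that by (intro sum.mono_neutral_left) (auto simp: binomial_eq_0)
    finally show ?thesis .
  qed
  then have "(\<Sum>j\<le>k. lag_coeff k j * complex_of_real ((cmod (z - w))\<^sup>2) ^ j)
      = (\<Sum>j\<le>k. \<Sum>a\<le>k. lag_coeff k j * (of_nat (j choose a) * z ^ a * (- w) ^ (j - a)) * (cnj z - cnj w) ^ j)"
    by (simp add: sq power_mult_distrib sum_distrib_left sum_distrib_right mult.assoc del: of_real_power)
  then have L: "complex_of_real (laguerre k 0 ((cmod (z - w))\<^sup>2 / 2))
      = (\<Sum>a\<le>k. \<Sum>j\<le>k. lag_coeff k j * (of_nat (j choose a) * z ^ a * (- w) ^ (j - a)) * (cnj z - cnj w) ^ j)"
    unfolding laguerre_0_eq by (subst sum.swap) simp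
  have "complex_of_real (exp ((cmod z)\<^sup>2 / 4)) * (laguerre_fun k (z - w) * twist z (z - w))
    = complex_of_real (laguerre k 0 ((cmod (z - w))\<^sup>2 / 2)) *
      (complex_of_real (exp ((cmod z)\<^sup>2 / 4)) * (complex_of_real (exp (- (cmod (z - w))\<^sup>2 / 4)) * twist z (z - w)))"
    by (simp add: laguerre_fun_def mult_ac)
  also have "\<dots> = complex_of_real (exp (- (1 / 4) * (cmod w)\<^sup>2)) * (\<Sum>a\<le>k. z ^ a * lag_slice k a (cnj z) w)"
    unfolding E L lag_slice_def by (simp add: sum_distrib_left sum_distrib_right mult_ac)
  finally show ?thesis .
qed

context L2_borel
begin

text \<open>The substitution of z - w for w moves the translation from \<open>f\<close> to the
  explicit kernel.\<close>

lemma twisted_conv_laguerre_eq: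
  assumes ae: "AE w in lborel. h w = f w"
  shows "complex_of_real (exp ((cmod z)\<^sup>2 / 4)) * twisted_conv h (laguerre_fun k) z
    = (\<Sum>a\<le>k. z ^ a * pairing (lag_slice k a (cnj z)))"
proof -
  have "twisted_conv h (laguerre_fun k) z = (LINT w|lborel. f (z - w) * laguerre_fun k w * twist z w)"
    by (rule twisted_conv_borel[OF meas ae])
  also have "\<dots> = (LINT w|lborel. f w * (laguerre_fun k (z - w) * twist z (z - w)))"
    by (subst distr_lborel_minus[of z, symmetric], subst integral_distr) (auto simp: mult.assoc)
  finally have "complex_of_real (exp ((cmod z)\<^sup>2 / 4)) * twisted_conv h (laguerre_fun k) z
    = (LINT w|lborel. f w * (complex_of_real (exp ((cmod z)\<^sup>2 / 4)) * (laguerre_fun k (z - w) * twist z (z - w))))"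
    by (simp only: integral_mult_right_zero[symmetric] mult.left_commute[of _ "f _"])
  also have "\<dots> = pairing (\<lambda>w. \<Sum>a\<le>k. z ^ a * lag_slice k a (cnj z) w)"
    unfolding twisted_laguerre_kernel pairing_def ..
  also have "\<dots> = (\<Sum>a\<le>k. z ^ a * pairing (lag_slice k a (cnj z)))"
    by (subst pairing_sum) (intro exp_bounded_intros, simp add: pairing_mult)
  finally show ?thesis .
qed

text \<open>The radial \<phi>_k acts as the weight in the averaging over circles. The means are
  those of \<open>h\<close> itself: a circle is a null set, so passing to the Borel version
  \<open>f\<close> can change individual means.\<close>

lemma twisted_conv_real_eq_0:
  assumes ae: "AE w in lborel. h w = f w"
    and mean: "\<And>r. r > 0 \<Longrightarrow> twisted_spherical_mean h r (complex_of_real x) = 0"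
  shows "twisted_conv h (laguerre_fun k) (complex_of_real x) = 0"
proof -
  define z where "z = complex_of_real x"
  define \<phi> where "\<phi> r = laguerre_fun k (complex_of_real r)" for r
  have [measurable]: "\<phi> \<in> borel_measurable borel" unfolding \<phi>_def by measurable
  have \<phi>: "\<phi> (cmod w) = laguerre_fun k w" for w
    by (simp add: \<phi>_def laguerre_fun_def)
  have "integrable lborel (\<lambda>w. f w * (complex_of_real (exp (- (1 / 4) * (cmod w)\<^sup>2)) * (\<Sum>a\<le>k. z ^ a * lag_slice k a (cnj z) w)))"
    by (intro integrable_pairing exp_bounded_intros)
  then have "integrable lborel (\<lambda>w. f w * (complex_of_real (exp ((cmod z)\<^sup>2 / 4)) * (laguerre_fun k (z - w) * twist z (z - w))))"
    unfolding twisted_laguerre_kernel .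
  then have I: "integrable lborel (\<lambda>w. complex_of_real (exp (- (cmod z)\<^sup>2 / 4)) * (f w * (complex_of_real (exp ((cmod z)\<^sup>2 / 4)) * (laguerre_fun k (z - w) * twist z (z - w)))))"
    by (rule integrable_mult_right)
  \<comment> \<open>Integrability is known for the kernel multiplied by exp (|z|^2 / 4); this
    constant is now removed again.\<close>
  have "complex_of_real (exp (- (cmod z)\<^sup>2 / 4)) * complex_of_real (exp ((cmod z)\<^sup>2 / 4)) = 1"
    by (simp add: of_real_mult[symmetric] exp_add[symmetric] del: of_real_mult)
  then have C: "complex_of_real (exp (- (cmod z)\<^sup>2 / 4)) * (v * (complex_of_real (exp ((cmod z)\<^sup>2 / 4)) * u)) = v * u" for u v
    by (metis (no_types, lifting) mult.assoc mult.commute mult.right_neutral)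
  have int: "integrable lborel (\<lambda>w. f w * (laguerre_fun k (z - w) * twist z (z - w)))"
    using I unfolding C .
  have "integrable (distr lborel borel (\<lambda>w. z - w)) (\<lambda>w. f w * (laguerre_fun k (z - w) * twist z (z - w)))"
    unfolding distr_lborel_minus by (rule int)
  then have "integrable lborel (\<lambda>w. f (z - w) * (laguerre_fun k w * twist z w))"
    by (subst (asm) integrable_distr_eq) auto
  then have "(LINT w|lborel. f (z - w) * twist z w * \<phi> (cmod w)) = 0"
    using AE_lborel_minus[OF ae, of z] mean
    by (intro integral_radial_weight_eq_0[where h = "\<lambda>w. h (z - w) * twist z w"])
      (auto simp: \<phi> mult_ac z_def twisted_spherical_mean_def elim!: eventually_mono)
  then show ?thesis
    unfolding twisted_conv_borel[OF meas ae] by (simp add: \<phi> z_def mult_ac)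
qed

text \<open>On the line of real multiples of \<open>u\<close> the expansion is regrouped by total
  degree \<open>n\<close>; there is no term with a > n.\<close>

lemma lag_pairing_ray_sums:
  "(\<lambda>n. complex_of_real t ^ n * (\<Sum>a\<le>k. if n < a then 0 else lag_pairing k a (n - a) * u ^ a * cnj u ^ (n - a)))
     sums (\<Sum>a\<le>k. (complex_of_real t * u) ^ a * pairing (lag_slice k a (cnj (complex_of_real t * u))))"
proof -
  define z where "z = complex_of_real t * u"
  have "(\<lambda>n. if n < a then 0 else z ^ a * (lag_pairing k a (n - a) * cnj z ^ (n - a))) sums (z ^ a * pairing (lag_slice k a (cnj z)))" for a
    using sums_mult[OF lag_pairing_sums[of k a "cnj z"], of "z ^ a"]
    by (subst sums_zero_iff_shift[of a, symmetric]) simp_all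
  then have "(\<lambda>n. \<Sum>a\<le>k. if n < a then 0 else z ^ a * (lag_pairing k a (n - a) * cnj z ^ (n - a))) sums (\<Sum>a\<le>k. z ^ a * pairing (lag_slice k a (cnj z)))"
    by (intro sums_sum)
  moreover have "(\<Sum>a\<le>k. if n < a then 0 else z ^ a * (lag_pairing k a (n - a) * cnj z ^ (n - a)))
     = complex_of_real t ^ n * (\<Sum>a\<le>k. if n < a then 0 else lag_pairing k a (n - a) * u ^ a * cnj u ^ (n - a))" for n
    unfolding sum_distrib_left
  proof (intro sum.cong refl)
    fix a
    have "complex_of_real t ^ n = complex_of_real t ^ a * complex_of_real t ^ (n - a)" if "\<not> n < a"
      using that by (simp add: power_add[symmetric])
    then show "(if n < a then 0 else z ^ a * (lag_pairing k a (n - a) * cnj z ^ (n - a)))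
       = complex_of_real t ^ n * (if n < a then 0 else lag_pairing k a (n - a) * u ^ a * cnj u ^ (n - a))"
      by (auto simp: z_def power_mult_distrib)
  qed
  ultimately show ?thesis by (simp add: z_def)
qed

text \<open>Comparison with the polynomial on every line through the origin identifies the
  homogeneous parts, so those of large degree vanish. The real line gives the vanishing of each
  homogeneous part at u = 1. The diagonal argument needs exactly these two facts and the
  recurrence.\<close>

lemma lag_pairing_top_eq_0:
  assumes poly: "polynomial_z_cnj (\<lambda>z. \<Sum>a\<le>k. z ^ a * pairing (lag_slice k a (cnj z)))"
    and zero: "\<And>x. (\<Sum>a\<le>k. complex_of_real x ^ a * pairing (lag_slice k a (cnj (complex_of_real x)))) = 0"
  shows "lag_pairing k k b = 0"
proof -
  obtain N c where c: "\<And>z. (\<Sum>a\<le>k. z ^ a * pairing (lag_slice k a (cnj z)))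
      = (\<Sum>i\<le>N. \<Sum>j\<le>N. c i j * z ^ i * cnj z ^ j)"
    using poly unfolding polynomial_z_cnj_def by blast
  \<comment> \<open>Homogeneous parts of degree \<open>n\<close> at \<open>u\<close>:
    \<open>e\<close> of the expansion, \<open>p\<close> of the polynomial.\<close>
  define e where "e u n = (\<Sum>a\<le>k. if n < a then 0 else lag_pairing k a (n - a) * u ^ a * cnj u ^ (n - a))" for u n
  define p where "p u n = (\<Sum>i\<le>N. \<Sum>j\<le>N. if n = i + j then c i j * u ^ i * cnj u ^ j else 0)" for u n
  have p_sums: "(\<lambda>n. complex_of_real t ^ n * p u n) sums (\<Sum>i\<le>N. \<Sum>j\<le>N. c i j * (complex_of_real t * u) ^ i * cnj (complex_of_real t * u) ^ j)" for t u
  proof -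
    have "(\<lambda>n. if n = i + j then complex_of_real t ^ n * (c i j * u ^ i * cnj u ^ j) else 0) sums
        (c i j * (complex_of_real t * u) ^ i * cnj (complex_of_real t * u) ^ j)" for i j
      using sums_single[of "i + j" "\<lambda>n. complex_of_real t ^ n * (c i j * u ^ i * cnj u ^ j)"]
      by (simp add: power_add power_mult_distrib mult_ac)
    then have "(\<lambda>n. \<Sum>i\<le>N. \<Sum>j\<le>N. if n = i + j then complex_of_real t ^ n * (c i j * u ^ i * cnj u ^ j) else 0) sums
        (\<Sum>i\<le>N. \<Sum>j\<le>N. c i j * (complex_of_real t * u) ^ i * cnj (complex_of_real t * u) ^ j)"
      by (intro sums_sum)
    then show ?thesis
      by (simp add: p_def sum_distrib_left if_distrib[of "\<lambda>x. _ * x"] cong: if_cong)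
  qed
  have ep: "e u n = p u n" for u n
  proof -
    have "e u n - p u n = 0"
    proof (rule powser_zero_on_reals)
      fix t
      show "(\<lambda>n. complex_of_real t ^ n * (e u n - p u n)) sums 0"
        using sums_diff[OF lag_pairing_ray_sums[of t k u] p_sums[of t u]]
        by (simp only: c e_def right_diff_distrib diff_self)
    qed
    then show ?thesis by simp
  qed
  have e1: "e 1 n = 0" for n
  proof (rule powser_zero_on_reals)
    show "(\<lambda>n. complex_of_real t ^ n * e 1 n) sums 0" for t
      using lag_pairing_ray_sums[of t k 1] zero[of t] by (simp add: e_def)
  qed
  show ?thesis
  proof (rule diagonal_coefficients_vanish[where M = "2 * N" and c = "lag_pairing k" and k = k])
    show "2 * of_nat (Suc a) * of_nat (Suc b) * lag_pairing k (Suc a) (Suc b)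
        = (of_nat a - of_nat k) * lag_pairing k a b" for a b
      unfolding lag_pairing_def pairing_mult[symmetric] lag_fps_nth_rec ..
    show "(\<Sum>a\<le>k. if n < a then 0 else lag_pairing k a (n - a)) = 0" for n
      using e1[of n] by (simp add: e_def cong: if_cong)
    fix n a assume n: "2 * N < n" and a: "a \<le> k" "a \<le> n"
    have "(if n < a then 0 else lag_pairing k a (n - a)) = 0"
    proof (rule polynomial_zero_on_circle[OF _ a(1)])
      fix v :: complex assume v: "cmod v = 1"
      \<comment> \<open>For |u| = 1 the product of u^n with u^a cnj(u)^(n - a) is u^(2 a). A square
        root of \<open>v\<close> thus turns the homogeneous part into a polynomial in
        \<open>v\<close>, whose coefficients are determined on the unit circle.\<close>
      define u where "u = csqrt v"
      have u2: "u\<^sup>2 = v" by (simp add: u_def)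
      have "(cmod u)\<^sup>2 = 1" using v by (simp add: norm_power[symmetric] u2)
      then have uu: "u * cnj u = 1" by (simp add: complex_norm_square[symmetric])
      have "p u n = 0"
        unfolding p_def using n by (intro sum.neutral ballI) auto
      then have "u ^ n * e u n = 0" by (simp add: ep)
      moreover have "u ^ n * (if n < a then 0 else lag_pairing k a (n - a) * u ^ a * cnj u ^ (n - a))
         = (if n < a then 0 else lag_pairing k a (n - a)) * v ^ a" for a
      proof (cases "n < a")
        case False
        have "u ^ n * cnj u ^ (n - a) = u ^ a * (u * cnj u) ^ (n - a)"
          using False by (simp add: power_mult_distrib mult.assoc[symmetric] power_add[symmetric])
        also have "\<dots> = u ^ a" by (simp add: uu)
        finally have "u ^ n * (lag_pairing k a (n - a) * u ^ a * cnj u ^ (n - a)) = lag_pairing k a (n - a) * (u ^ a * u ^ a)"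
          by (metis mult.assoc mult.commute)
        then show ?thesis using False by (simp add: u2[symmetric] power_mult[symmetric] power_add[symmetric] mult_2)
      qed simp
      ultimately show "(\<Sum>a\<le>k. (if n < a then 0 else lag_pairing k a (n - a)) * v ^ a) = 0"
        by (simp only: e_def sum_distrib_left)
    qed
    then show "lag_pairing k a (n - a) = 0" using a by simp
  qed
qed

end

theorem theorem3p4:
  fixes f :: "complex \<Rightarrow> complex"
  assumes "square_integrable f"
    and "\<And>k::nat. polynomial_z_cnj
           (\<lambda>z. complex_of_real (exp ((cmod z)\<^sup>2 / 4)) * twisted_conv f (laguerre_fun k) z)"
    and "\<And>(r::real) (x::real). r > 0 \<Longrightarrow> twisted_spherical_mean f r (complex_of_real x) = 0"
  shows "AE z in lebesgue. f z = 0"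
proof -
  have f: "f \<in> borel_measurable lebesgue" "integrable lebesgue (\<lambda>z. (cmod (f z))\<^sup>2)"
    using assms(1) by (auto simp: square_integrable_def)
  \<comment> \<open>The moment argument runs for a Borel representative \<open>g\<close>, while the
    assumptions on convolutions and circular means remain those of \<open>f\<close>.\<close>
  obtain g where g [measurable]: "g \<in> borel_measurable borel" and ae: "AE w in lborel. f w = g w"
    using lebesgue_measurable_ex_borel[OF f(1)] .
  have "integrable lebesgue (\<lambda>z. (cmod (g z))\<^sup>2)"
  proof (rule integrable_cong_AE_imp[OF f(2)])
    show "AE z in lebesgue. (cmod (f z))\<^sup>2 = (cmod (g z))\<^sup>2"
      using AE_completion[OF ae] by eventually_elim simp
  qed (rule measurable_completion, simp)
  then have "integrable lborel (\<lambda>z. (cmod (g z))\<^sup>2)"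
    by (subst (asm) integrable_completion) auto
  then interpret L2_borel g by unfold_locales (rule g)
  note eq = twisted_conv_laguerre_eq[OF ae]
  have "lag_pairing k k b = 0" for k b
  proof (rule lag_pairing_top_eq_0)
    show "polynomial_z_cnj (\<lambda>z. \<Sum>a\<le>k. z ^ a * pairing (lag_slice k a (cnj z)))"
      using assms(2)[of k] unfolding eq .
    show "(\<Sum>a\<le>k. complex_of_real x ^ a * pairing (lag_slice k a (cnj (complex_of_real x)))) = 0" for x
      unfolding eq[symmetric] using twisted_conv_real_eq_0[OF ae assms(3)] by simp
  qed
  then have "AE w in lborel. g w = 0"
    by (intro AE_zero_if_gauss_moment_zero gauss_moment_zero_if_lag_pairing_zero)
  with ae have "AE w in lborel. f w = 0"
    by eventually_elim simp
  then show ?thesis by (rule AE_completion)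
qed

end
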